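(* Let $i,j,k\in\mathbb{N}\cup\{0\}$ be distinct non-negative integers (that is, $i\neq j\neq k\neq i$). Then the three loop function $\phi_{i,j,k}:\mathbb{Z}[\mathscr{K}]\to\mathbb{Z}$ is an invariant of virtual knots; i.e. the integer $\phi_{i,j,k}(K)$ computed from a Gauss diagram of a virtual knot $K$ depends only on the virtual knot $K$.
   Context: A virtual knot diagram is an oriented immersed circle in $\mathbb{R}^2$ with finitely many transverse double points, each marked as a classical crossing (with over/under information) or as a virtual crossing. $\mathscr{K}$ denotes the set of virtual knots: virtual knot diagrams modulo the extended Reidemeister moves (classical moves 1, 2, 3, together with the usual non-classical virtual and mixed moves). $\mathbb{Z}[\mathscr{K}]$ is the free abelian group on $\mathscr{K}$; functions on virtual knots are extended linearly. The Gauss diagram of a virtual knot diagram is a counterclockwise oriented circle with, for each classical crossing, a chord joining its two preimages, directed from the over-crossing to the under-crossing preimage (an "arrow") and decorated with the sign $\pm1$ of the crossing. Virtual knots are equivalently Gauss diagrams modulo the moves induced by the classical Reidemeister moves. Two arrows intersect if their chords cross inside the disk, i.e. their endpoints are linked on the circle. Intersection sign: if arrows $x$ and $c$ intersect, $int_c(x)=+1$ if, when $c$ is drawn pointing upward, $x$ crosses $c$ from left to right, and $int_c(x)=-1$ otherwise. Let $D$ be a Gauss diagram and $D'$ a subdiagram consisting of two non-intersecting arrows; $sign(D')$ is the product of the signs of its two arrows. The two chords cut the disk into three regions: a middle region adjacent to both arrows and two outer regions, each adjacent to one arrow. (These correspond to the three components $A_1,A_2,A_3$ obtained by oriented smoothing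 along both arrows.) The outer arc of an arrow of $D'$ is the arc of the circle bounding its outer region. Call an arrow of $D'$ of type t if traversing its outer arc counterclockwise goes from its tail to its head, and of type h if it goes from its head to its tail. Relative weights of pairs of regions: for two regions $A_p,A_q$ let $C_{p,q}$ be the set of arrows of $D$ having one endpoint on the boundary circle arcs of $A_p$ and one on those of $A_q$ (arrows of $D'$ excluded). Let $a_{pq}$ be the arrow of $D'$ separating them if they are adjacent, and either arrow of $D'$ if they are the two outer regions. Put $w_{pq}=\left|\sum_{c\in C_{p,q}} sign(c)\,int_{a_{pq}}(c)\right|$ (independent of the choice of $a_{pq}$). Each of the three pairs of regions of $D'$ is labeled by its relative weight. For $i,j,k\in\mathbb{N}\cup\{0\}$ define $\langle F_{i,j,k},D'\rangle = sign(D')$ if one of the following holds, and $\langle F_{i,j,k},D'\rangle=0$ otherwise: (M) $D'$ has one arrow of type t and one of type h, the pair (outer region of the t-arrow, middle) has label $i$, the pair (middle, outer region of the h-arrow) has label $j$, and the pair of outer regions has label $k$; (TT) both arrows are of type t, the pair of outer regions has label $i$, and the two pairs (middle, outer) have labels $j,k$ in some order; (HH) both arrows are of type h, the pair of outer regions has label $j$, and the two pairs (middle, outer) have labels $i,k$ in some order. ($F_{i,j,k}$ is the formal sum of the three labeled diagrams M, TT, HH.) The three loop function is $\phi_{i,j,k}(K)=\sum_{D'\subset D}\langle F_{i,j,k},D'\rangle$, the sum over all subdiagrams $D'$ of $D$ with two non-intersecting arrows, where $D$ is a Gauss diagram of $K$. *)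

theory Defs
  imports "HOL-Library.Poly_Mapping"
begin

section \<open>Gauss diagrams\<close>

text \<open>
  An arrow carries its sign. The tail of an arrow is the over-crossing preimage of the crossing,
  its head the under-crossing preimage.
\<close>

datatype arrow = Arrow (ident: nat) (positive: bool)

definition sign :: "arrow \<Rightarrow> int" where
  "sign a = (if positive a then 1 else -1)"

datatype endpt = Tail arrow | Head arrow

text \<open>
  A Gauss diagram is given by the endpoints of its arrows, read counterclockwise along the circle
  from some base point. Neither the base point nor the identifiers of the arrows are part of the
  diagram: codes that differ in them only are identified by \<open>same_diagram\<close> below.
\<close>

typedef gauss_diagram =
    "{w :: endpt list. distinct w \<and> (\<forall>a. Tail a \<in> set w \<longleftrightarrow> Head a \<in> set w)}"
  morphisms code Gauss_diagram
  by (rule exI[of _ "[]"]) simp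

definition arrows :: "gauss_diagram \<Rightarrow> arrow set" where
  "arrows D = {a. Tail a \<in> set (code D)}"

inductive same_diagram :: "gauss_diagram \<Rightarrow> gauss_diagram \<Rightarrow> bool" where
  rotation: "same_diagram D D'"
    if "code D = u @ v" and "code D' = v @ u"
| relabeling: "same_diagram D D'"
    if "inj_on f (arrows D)" and "\<And>a. a \<in> arrows D \<Longrightarrow> sign (f a) = sign a"
      and "code D' = map (case_endpt (\<lambda>a. Tail (f a)) (\<lambda>a. Head (f a))) (code D)"


section \<open>Reidemeister moves and virtual knots\<close>

definition ordered_pair :: "int \<Rightarrow> 'a \<Rightarrow> 'a \<Rightarrow> 'a list" where
  "ordered_pair s p q = (if s = 1 then [p, q] else [q, p])"

text \<open>
  The Gauss diagram of three pairwise crossing strands, each consisting of two consecutive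
  endpoints: \<open>a\<close> is the crossing of the top with the middle strand, \<open>b\<close> of the top with the bottom
  strand, and \<open>c\<close> of the middle with the bottom strand. To see which orders of the
  endpoints and which signs occur, let the strands be straight lines with directions
  \<open>t\<close>, \<open>m\<close>, \<open>n\<close> (top, middle, bottom). A crossing is positive iff (over, under) is a positive
  basis of the plane, so the signs of \<open>a\<close>, \<open>b\<close>, \<open>c\<close> are those of \<open>det (t, m)\<close>, \<open>det (t, n)\<close>,
  \<open>det (m, n)\<close>. Write \<open>b - a = x t\<close>, \<open>c - a = y m\<close>, \<open>c - b = z n\<close> for the crossing points.
  Then \<open>x t + z n = y m\<close>; taking determinants with \<open>m\<close> and with \<open>n\<close> shows that the signs of
  \<open>(x, y, z)\<close> are either equal or opposite to the signs of \<open>(c, b, a)\<close>. All eight sign patterns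
  occur, each in both ways, and moving one strand across the crossing of the other two
  exchanges the two ways.
\<close>

definition r3_strands :: "int \<Rightarrow> arrow \<Rightarrow> arrow \<Rightarrow> arrow \<Rightarrow> endpt list set" where
  "r3_strands e a b c =
    {ordered_pair (e * sign c) (Tail a) (Tail b),
     ordered_pair (e * sign b) (Head a) (Tail c),
     ordered_pair (e * sign a) (Head b) (Head c)}"

text \<open>
  Arrows that are created by a move are new automatically, since the code of a diagram is
  distinct. The strands taking part in a move may be connected outside of it in any way.
\<close>

inductive reidemeister :: "gauss_diagram \<Rightarrow> gauss_diagram \<Rightarrow> bool" where
  R1: "reidemeister D D'"
    if "code D = u @ v" and "code D' = u @ p @ v"
      and "p \<in> {[Tail a, Head a], [Head a, Tail a]}"
| R2: "reidemeister D D'"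
    if "code D = u @ v @ w" and "code D' = u @ [Tail a, Tail b] @ v @ p @ w"
      and "p \<in> {[Head a, Head b], [Head b, Head a]}" and "sign b = - sign a"
| R3: "reidemeister D D'"
    if "code D = u @ p @ v @ q @ w @ r @ z"
      and "code D' = u @ rev p @ v @ rev q @ w @ rev r @ z"
      and "{p, q, r} = r3_strands e a b c" and "e \<in> {1, -1}"

quotient_type virtual_knot = gauss_diagram / "equivclp (sup same_diagram reidemeister)"
  morphisms rep_virtual_knot virtual_knot_of
  by simp


section \<open>Arcs, intersections and regions\<close>

text \<open>
  The endpoints met strictly between \<open>p\<close> and \<open>q\<close> when traversing the circle counterclockwise
  from \<open>p\<close> to \<open>q\<close>. Arcs and regions are represented by the endpoints that lie on them.
\<close>

definition arc :: "gauss_diagram \<Rightarrow> endpt \<Rightarrow> endpt \<Rightarrow> endpt set" where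
  "arc D p q = {r. \<exists>n u v w. rotate n (code D) = p # u @ r # v @ q # w}"

text \<open>
  If \<open>c\<close> is drawn pointing upward, the arc from its tail to its head is on the right, and the
  arc from its head to its tail is on the left.
\<close>

definition right_arc :: "gauss_diagram \<Rightarrow> arrow \<Rightarrow> endpt set" where
  "right_arc D c = arc D (Tail c) (Head c)"

definition left_arc :: "gauss_diagram \<Rightarrow> arrow \<Rightarrow> endpt set" where
  "left_arc D c = arc D (Head c) (Tail c)"

definition intersecting :: "gauss_diagram \<Rightarrow> arrow \<Rightarrow> arrow \<Rightarrow> bool" where
  "intersecting D c x \<longleftrightarrow>
    Tail x \<in> left_arc D c \<and> Head x \<in> right_arc D c \<or>
    Tail x \<in> right_arc D c \<and> Head x \<in> left_arc D c"

definition int_sign :: "gauss_diagram \<Rightarrow> arrow \<Rightarrow> arrow \<Rightarrow> int" where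
  "int_sign D c x = (if Tail x \<in> left_arc D c \<and> Head x \<in> right_arc D c then 1 else -1)"

text \<open>
  In what follows \<open>x\<close> and \<open>y\<close> are the two arrows of a subdiagram, and they do not intersect.
  The outer arc of \<open>x\<close> is the arc that contains no endpoint of \<open>y\<close>.
\<close>

definition type_t :: "gauss_diagram \<Rightarrow> arrow \<Rightarrow> arrow \<Rightarrow> bool" where
  "type_t D x y \<longleftrightarrow> arc D (Tail x) (Head x) \<inter> {Tail y, Head y} = {}"

definition type_h :: "gauss_diagram \<Rightarrow> arrow \<Rightarrow> arrow \<Rightarrow> bool" where
  "type_h D x y \<longleftrightarrow> arc D (Head x) (Tail x) \<inter> {Tail y, Head y} = {}"

definition outer :: "gauss_diagram \<Rightarrow> arrow \<Rightarrow> arrow \<Rightarrow> endpt set" where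
  "outer D x y = (if type_t D x y then arc D (Tail x) (Head x) else arc D (Head x) (Tail x))"

definition middle :: "gauss_diagram \<Rightarrow> arrow \<Rightarrow> arrow \<Rightarrow> endpt set" where
  "middle D x y = set (code D) - {Tail x, Head x, Tail y, Head y} - outer D x y - outer D y x"

definition connecting ::
    "gauss_diagram \<Rightarrow> arrow \<Rightarrow> arrow \<Rightarrow> endpt set \<Rightarrow> endpt set \<Rightarrow> arrow set" where
  "connecting D x y P Q =
    {c \<in> arrows D - {x, y}. Tail c \<in> P \<and> Head c \<in> Q \<or> Tail c \<in> Q \<and> Head c \<in> P}"

definition weight ::
    "gauss_diagram \<Rightarrow> arrow \<Rightarrow> arrow \<Rightarrow> arrow \<Rightarrow> endpt set \<Rightarrow> endpt set \<Rightarrow> nat" where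
  "weight D x y a P Q = nat \<bar>\<Sum>c\<in>connecting D x y P Q. sign c * int_sign D a c\<bar>"

definition inner_label :: "gauss_diagram \<Rightarrow> arrow \<Rightarrow> arrow \<Rightarrow> nat" where
  "inner_label D x y = weight D x y x (outer D x y) (middle D x y)"

text \<open>
  The label of the two outer regions does not depend on whether intersection signs are taken
  with \<open>x\<close> or with \<open>y\<close>.
\<close>

definition outer_label :: "gauss_diagram \<Rightarrow> arrow \<Rightarrow> arrow \<Rightarrow> nat" where
  "outer_label D x y = weight D x y x (outer D x y) (outer D y x)"


section \<open>The three loop function\<close>

definition matches_M :: "nat \<Rightarrow> nat \<Rightarrow> nat \<Rightarrow> gauss_diagram \<Rightarrow> arrow \<Rightarrow> arrow \<Rightarrow> bool" where
  "matches_M i j k D x y \<longleftrightarrow> type_t D x y \<and> type_h D y x \<and>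
    inner_label D x y = i \<and> inner_label D y x = j \<and> outer_label D x y = k"

definition matches_TT :: "nat \<Rightarrow> nat \<Rightarrow> nat \<Rightarrow> gauss_diagram \<Rightarrow> arrow \<Rightarrow> arrow \<Rightarrow> bool" where
  "matches_TT i j k D x y \<longleftrightarrow> type_t D x y \<and> type_t D y x \<and>
    outer_label D x y = i \<and> inner_label D x y = j \<and> inner_label D y x = k"

definition matches_HH :: "nat \<Rightarrow> nat \<Rightarrow> nat \<Rightarrow> gauss_diagram \<Rightarrow> arrow \<Rightarrow> arrow \<Rightarrow> bool" where
  "matches_HH i j k D x y \<longleftrightarrow> type_h D x y \<and> type_h D y x \<and>
    outer_label D x y = j \<and> inner_label D x y = i \<and> inner_label D y x = k"

text \<open>
  Quantifying over both namings of the arrows of the subdiagram accounts for the labels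
  that are given up to order.
\<close>

definition pairing :: "nat \<Rightarrow> nat \<Rightarrow> nat \<Rightarrow> gauss_diagram \<Rightarrow> arrow set \<Rightarrow> int" where
  "pairing i j k D S =
    (if \<exists>x y. x \<noteq> y \<and> S = {x, y} \<and>
        (matches_M i j k D x y \<or> matches_TT i j k D x y \<or> matches_HH i j k D x y)
     then \<Prod>a\<in>S. sign a else 0)"

definition nonintersecting_pairs :: "gauss_diagram \<Rightarrow> arrow set set" where
  "nonintersecting_pairs D =
    {S. S \<subseteq> arrows D \<and> card S = 2 \<and> (\<forall>x\<in>S. \<forall>y\<in>S. \<not> intersecting D x y)}"

definition three_loop :: "nat \<Rightarrow> nat \<Rightarrow> nat \<Rightarrow> gauss_diagram \<Rightarrow> int" where
  "three_loop i j k D = (\<Sum>S\<in>nonintersecting_pairs D. pairing i j k D S)"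

end

theory Submission
  imports Defs
begin

text \<open>
  Call the flow from a region of the disk to another one the signed number of arrows that lead
  from the first to the second, arrows in the reverse direction being counted negatively. An arrow
  that connects two regions crosses every arrow of the subdiagram separating them, and the
  direction of its crossing says which way it leads. So a relative weight is the absolute
  value of a flow (\<open>weight_eq_flow\<close>), and the contribution of a pair of disjoint arrows
  is determined by the types of the two arrows and by the three flows between its regions
  (\<open>pair_value_eq\<close>, \<open>pair_match_cong\<close>). All of this depends on the cyclic
  order of the endpoints only, which is the reason why base point and names are irrelevant.

  A pair of arrows that survives a first or second move keeps its flows: the arrow of a first move
  has both ends in one region, and the two arrows of a second move lead from the same region to the
  same region with opposite signs. A pair with a new arrow contributes only if
  its three labels are \<open>i\<close>, \<open>j\<close>, \<open>k\<close> in some order, hence distinct. But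
  the arrow of a first move has an empty outer region, and if the two arrows of a second move are
  disjoint then the region between them is empty, so in both cases two labels vanish. The pairs of
  a third arrow with either arrow of a second move have equal labels and opposite signs.

  For the third move, consider first a pair of one of its arrows with a bystander. The other two
  arrows of the triangle each change the side of that arrow, but they lead to a common region; the
  geometry of the triangle forces them either to exchange their roles or to cancel both before
  and after the move (\<open>r3_bystander\<close>). There remain the pairs within the triangle. The three
  strands cut the circle into three arcs, and each disjoint pair has these arcs as its regions, so
  all these pairs have the same three labels. Of the three arrows, \<open>a\<close> and \<open>c\<close> have
  the same type and \<open>b\<close> has the other type; therefore the pair of \<open>a\<close> and \<open>c\<close>
  has matching labels iff exactly one of the pairs with \<open>b\<close> has. The move makes every
  disjoint pair of the triangle intersect and vice versa. If the two pairs with matching labels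
  are disjoint on the same side of the move, their contributions are opposite; if they are
  disjoint on different sides, their contributions are equal (\<open>triangle_exchange\<close>).
\<close>

section \<open>Cyclic order of endpoints\<close>

primrec before :: "'a list \<Rightarrow> 'a \<Rightarrow> 'a \<Rightarrow> bool" where
  "before [] p q \<longleftrightarrow> False"
| "before (x # w) p q \<longleftrightarrow> p = x \<and> q \<in> set w \<or> before w p q"

lemma before_append:
  "before (u @ v) p q \<longleftrightarrow> before u p q \<or> before v p q \<or> p \<in> set u \<and> q \<in> set v"
  by (induction u) auto

lemma before_imp_mem: "before w p q \<Longrightarrow> p \<in> set w \<and> q \<in> set w"
  by (induction w) auto

lemma not_before: "p \<notin> set w \<or> q \<notin> set w \<Longrightarrow> \<not> before w p q"
  using before_imp_mem by metis

lemma before_irrefl: "distinct w \<Longrightarrow> \<not> before w p p"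
  by (induction w) (auto simp: not_before)

lemma before_total:
  "distinct w \<Longrightarrow> r \<in> set w \<Longrightarrow> s \<in> set w \<Longrightarrow> r \<noteq> s \<Longrightarrow> before w s r \<longleftrightarrow> \<not> before w r s"
  by (induction w) (auto simp: not_before)

text \<open>
  Going around the closed-up word from \<open>p\<close>, one meets \<open>r\<close> before \<open>q\<close>. The
  disjuncts differ in where the base point of the word lies relative to the three points.
\<close>

definition cyclic :: "'a list \<Rightarrow> 'a \<Rightarrow> 'a \<Rightarrow> 'a \<Rightarrow> bool" where
  "cyclic w p r q \<longleftrightarrow>
    before w p r \<and> before w r q \<or> before w r q \<and> before w q p \<or> before w q p \<and> before w p r"

lemma cyclic_imp_mem: "cyclic w p r q \<Longrightarrow> p \<in> set w \<and> r \<in> set w \<and> q \<in> set w"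
  unfolding cyclic_def using before_imp_mem by metis

lemma cyclic_turn: "cyclic w p r q \<longleftrightarrow> cyclic w r q p"
  by (auto simp: cyclic_def)

lemma cyclic_swap:
  assumes "distinct w" "p \<in> set w" "q \<in> set w" "r \<in> set w" "p \<noteq> q" "r \<noteq> p" "r \<noteq> q"
  shows "cyclic w q r p \<longleftrightarrow> \<not> cyclic w p r q"
  using before_total[OF assms(1)] assms(2-) unfolding cyclic_def by metis

lemma cyclic_irrefl:
  assumes "distinct w"
  shows "\<not> cyclic w p p q" "\<not> cyclic w p q q" "\<not> cyclic w p q p"
  unfolding cyclic_def
  using before_irrefl[OF assms] before_total[OF assms] before_imp_mem[of w] by metis+

lemma cyclic_rotate1:
  assumes "distinct w"
  shows "cyclic (rotate1 w) p r q \<longleftrightarrow> cyclic w p r q"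
proof (cases w)
  case (Cons x xs)
  then have "x \<notin> set xs" using assms by simp
  then show ?thesis
    unfolding cyclic_def Cons by (auto simp: before_append not_before dest: before_imp_mem)
qed simp

lemma cyclic_rotate: "distinct w \<Longrightarrow> cyclic (rotate n w) p r q \<longleftrightarrow> cyclic w p r q"
  by (induction n) (simp_all add: cyclic_rotate1)

text \<open>
  Opening the circle at one end of a chord turns statements about that chord into membership
  in the two pieces \<open>A\<close> and \<open>B\<close> of the word.
\<close>

lemma cyclic_rotated_form:
  assumes "distinct w" "p \<in> set w" "q \<in> set w" "p \<noteq> q"
  obtains A B where "distinct (p # A @ q # B)" "set (p # A @ q # B) = set w"
    and "cyclic w = cyclic (p # A @ q # B)"
proof -
  obtain u v where w: "w = u @ p # v" using assms(2) split_list by metis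
  then have "q \<in> set (v @ u)" using assms by auto
  then obtain A B where AB: "v @ u = A @ q # B" using split_list by metis
  then have rot: "rotate (length u) w = p # A @ q # B" by (simp add: w rotate_append)
  show thesis
  proof (rule that)
    show "distinct (p # A @ q # B)" "set (p # A @ q # B) = set w"
      using assms(1) by (simp_all only: flip: rot) simp_all
    show "cyclic w = cyclic (p # A @ q # B)"
      by (intro ext) (simp add: cyclic_rotate[OF assms(1)] flip: rot)
  qed
qed

text \<open>
  This gives the symmetry of intersection: a chord separates the ends of another one iff the
  other one separates the ends of the first.
\<close>

lemma chords_linked_sym:
  assumes "distinct w" "distinct [p, q, p', q']" "{p, q, p', q'} \<subseteq> set w"
  shows "(cyclic w p p' q \<longleftrightarrow> cyclic w p q' q) \<longleftrightarrow> (cyclic w p' p q' \<longleftrightarrow> cyclic w p' q q')"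
proof -
  obtain A B where *: "distinct (p # A @ q # B)" "set (p # A @ q # B) = set w"
    "cyclic w = cyclic (p # A @ q # B)"
    using cyclic_rotated_form[of w p q] assms by auto
  have "p' \<in> set A \<or> p' \<in> set B" "q' \<in> set A \<or> q' \<in> set B" using assms *(2) by auto
  then show ?thesis using *(1) assms(2) unfolding *(3)
    by (elim disjE) (auto simp: cyclic_def before_append not_before dest: before_imp_mem)
qed

text \<open>
  Disjoint chords cut the disk into three regions rather than four: the far side of one
  chord lies on the near side of the other.
\<close>

lemma no_region_beyond_both:
  assumes "distinct w" "distinct [p, q, p', q']" "{p, q, p', q', r} \<subseteq> set w"
    and "r \<notin> {p, q, p', q'}"
    and "cyclic w p p' q \<longleftrightarrow> cyclic w p q' q"
  shows "(cyclic w p r q \<longleftrightarrow> cyclic w p p' q) \<or> (cyclic w p' r q' \<longleftrightarrow> cyclic w p' p q')"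
proof -
  obtain A B where *: "distinct (p # A @ q # B)" "set (p # A @ q # B) = set w"
    "cyclic w = cyclic (p # A @ q # B)"
    using cyclic_rotated_form[of w p q] assms by auto
  have "p' \<in> set A \<or> p' \<in> set B" "q' \<in> set A \<or> q' \<in> set B" "r \<in> set A \<or> r \<in> set B"
    using assms *(2) by auto
  then show ?thesis using *(1) assms(2,4,5) unfolding *(3)
    by (elim disjE) (auto simp: cyclic_def before_append not_before dest: before_imp_mem)
qed

lemma before_split: "before w p q \<Longrightarrow> \<exists>u v x. w = u @ p # v @ q # x"
proof (induction w)
  case (Cons y w)
  then show ?case
  proof (cases "p = y \<and> q \<in> set w")
    case True
    then show ?thesis by (metis append_Nil split_list)
  next
    case False
    then obtain u v x where "w = u @ p # v @ q # x" using Cons by auto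
    then show ?thesis by (metis append_Cons)
  qed
qed simp

text \<open>
  Three points \<open>p\<close>, \<open>q\<close>, \<open>s\<close> cut the circle into three arcs. According to the
  orientation \<open>\<theta>\<close> of the triple, \<open>X\<close>, \<open>Y\<close> and \<open>Z\<close> say that \<open>r\<close>
  lies on the arc with ends \<open>p, q\<close>, with ends \<open>p, s\<close>, and with ends \<open>q, s\<close>.
\<close>

lemma three_arcs:
  assumes "distinct w" "distinct [p, q, s, r]" "{p, q, s, r} \<subseteq> set w"
  defines "\<theta> \<equiv> cyclic w p s q"
  defines "X \<equiv> cyclic w p r q \<noteq> \<theta>" and "Y \<equiv> cyclic w p r s = \<theta>" and "Z \<equiv> cyclic w q r s \<noteq> \<theta>"
  shows "X \<and> \<not> Y \<and> \<not> Z \<or> \<not> X \<and> Y \<and> \<not> Z \<or> \<not> X \<and> \<not> Y \<and> Z"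
proof -
  obtain A B where *: "distinct (p # A @ q # B)" "set (p # A @ q # B) = set w"
    "cyclic w = cyclic (p # A @ q # B)"
    using cyclic_rotated_form[of w p q] assms(1-3) by auto
  have mem: "s \<in> set A \<or> s \<in> set B" "r \<in> set A \<or> r \<in> set B" using assms(2,3) *(2) by auto
  have "distinct A" "distinct B" "r \<noteq> s" using *(1) assms(2) by auto
  then show ?thesis
    using before_total[of A r s] before_total[of B r s] mem *(1) assms(2)
    unfolding X_def Y_def Z_def \<theta>_def *(3)
    by (elim disjE) (auto simp: cyclic_def before_append not_before dest: before_imp_mem)
qed

definition consecutive :: "'a list \<Rightarrow> 'a \<Rightarrow> 'a \<Rightarrow> bool" where
  "consecutive w p q \<longleftrightarrow> (\<exists>u v. w = u @ [p, q] @ v)"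

lemma consecutive_before:
  assumes "distinct w" "consecutive w p q"
  shows "before w p q" "\<not> before w q p"
    and "r \<notin> {p, q} \<Longrightarrow> before w r p \<longleftrightarrow> before w r q"
    and "r \<notin> {p, q} \<Longrightarrow> before w p r \<longleftrightarrow> before w q r"
proof -
  obtain u v where w: "w = u @ [p, q] @ v" using assms(2) unfolding consecutive_def by blast
  show "before w p q" "\<not> before w q p"
    "r \<notin> {p, q} \<Longrightarrow> before w r p \<longleftrightarrow> before w r q"
    "r \<notin> {p, q} \<Longrightarrow> before w p r \<longleftrightarrow> before w q r"
    using assms(1) unfolding w by (auto simp: before_append not_before dest: before_imp_mem)
qed

text \<open>
  Neighbouring points cannot be distinguished by the position of other points.
\<close>

lemma cyclic_consecutive:
  assumes "distinct w" "consecutive w p q" "x \<notin> {p, q}" "y \<notin> {p, q}"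
  shows "cyclic w x p y \<longleftrightarrow> cyclic w x q y"
    and "cyclic w p x y \<longleftrightarrow> cyclic w q x y"
    and "cyclic w x y p \<longleftrightarrow> cyclic w x y q"
  unfolding cyclic_def using consecutive_before[OF assms(1,2)] assms(3,4) by auto

lemma cyclic_within_consecutive:
  assumes "distinct w" "consecutive w p q" "x \<in> set w" "x \<notin> {p, q}"
  shows "cyclic w p q x" "\<not> cyclic w q p x" "\<not> cyclic w p x q" "cyclic w q x p"
    "cyclic w x p q" "\<not> cyclic w x q p"
proof -
  have m: "p \<in> set w" "q \<in> set w" "p \<noteq> q" using assms(1,2) by (auto simp: consecutive_def)
  have "before w x p \<longleftrightarrow> \<not> before w p x"
    using m assms by (intro before_total) auto
  then show "cyclic w p q x" "\<not> cyclic w q p x" "\<not> cyclic w p x q" "cyclic w q x p"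
    "cyclic w x p q" "\<not> cyclic w x q p"
    unfolding cyclic_def using consecutive_before[OF assms(1,2)] assms(4) by auto
qed

section \<open>Sides of an arrow\<close>

lemma distinct_code: "distinct (code D)"
  and Tail_in_code_iff: "Tail x \<in> set (code D) \<longleftrightarrow> x \<in> arrows D"
  and Head_in_code_iff: "Head x \<in> set (code D) \<longleftrightarrow> x \<in> arrows D"
  using code[of D] by (auto simp: arrows_def)

lemma mem_arc_iff: "r \<in> arc D p q \<longleftrightarrow> cyclic (code D) p r q"
proof
  assume "r \<in> arc D p q"
  then obtain n u v w where n: "rotate n (code D) = p # u @ r # v @ q # w"
    unfolding arc_def by blast
  have "cyclic (rotate n (code D)) p r q"
    unfolding cyclic_def n by (simp add: before_append)
  then show "cyclic (code D) p r q" by (simp add: cyclic_rotate distinct_code)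
next
  assume c: "cyclic (code D) p r q"
  then obtain u v where w: "code D = u @ p # v"
    using cyclic_imp_mem split_list by metis
  have rot: "rotate (length u) (code D) = p # v @ u"
    by (simp add: w rotate_append)
  have "p \<notin> set (v @ u)" using distinct_code[of D] by (simp add: w)
  moreover have "cyclic (p # v @ u) p r q"
    using c cyclic_rotate[OF distinct_code] rot by metis
  ultimately have "before (v @ u) r q"
    unfolding cyclic_def by (auto simp: not_before)
  then show "r \<in> arc D p q"
    unfolding arc_def using before_split rot by fastforce
qed

text \<open>
  This says that \<open>r\<close> is on the right of \<open>x\<close>. For the endpoints of other arrows,
  being on the left is the negation, so that one predicate describes both sides.
\<close>

definition side :: "gauss_diagram \<Rightarrow> arrow \<Rightarrow> endpt \<Rightarrow> bool" where
  "side D x r \<longleftrightarrow> cyclic (code D) (Tail x) r (Head x)"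

lemma finite_arrows: "finite (arrows D)"
proof -
  have "arrows D = Tail -` set (code D)" by (auto simp: arrows_def)
  then show ?thesis by (simp add: finite_vimageI inj_def)
qed

lemma mem_right_arc: "r \<in> right_arc D x \<longleftrightarrow> side D x r"
  by (simp add: right_arc_def mem_arc_iff side_def)

lemma mem_left_arc:
  assumes "x \<in> arrows D" "r \<in> set (code D)" "r \<noteq> Tail x" "r \<noteq> Head x"
  shows "r \<in> left_arc D x \<longleftrightarrow> \<not> side D x r"
  using assms cyclic_swap[OF distinct_code[of D], of "Tail x" "Head x" r]
  by (simp add: left_arc_def mem_arc_iff side_def Tail_in_code_iff Head_in_code_iff)

lemma intersecting_iff:
  assumes "x \<in> arrows D" "y \<in> arrows D" "x \<noteq> y"
  shows "intersecting D x y \<longleftrightarrow> side D x (Tail y) \<noteq> side D x (Head y)"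
  using assms
  by (auto simp: intersecting_def mem_right_arc mem_left_arc Tail_in_code_iff Head_in_code_iff)

lemma not_intersecting_self: "\<not> intersecting D x x"
  by (simp add: intersecting_def mem_right_arc left_arc_def mem_arc_iff side_def cyclic_irrefl distinct_code)

lemma side_linked_sym:
  assumes "x \<in> arrows D" "y \<in> arrows D" "x \<noteq> y"
  shows "(side D x (Tail y) \<longleftrightarrow> side D x (Head y)) \<longleftrightarrow> (side D y (Tail x) \<longleftrightarrow> side D y (Head x))"
  unfolding side_def using assms
  by (intro chords_linked_sym) (auto simp: distinct_code Tail_in_code_iff Head_in_code_iff)

lemma side_dichotomy:
  assumes "x \<in> arrows D" "y \<in> arrows D" "x \<noteq> y"
    and "side D x (Tail y) \<longleftrightarrow> side D x (Head y)"
    and "r \<in> set (code D)" "r \<notin> {Tail x, Head x, Tail y, Head y}"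
  shows "(side D x r \<longleftrightarrow> side D x (Tail y)) \<or> (side D y r \<longleftrightarrow> side D y (Tail x))"
  using assms no_region_beyond_both[OF distinct_code[of D], of "Tail x" "Head x" "Tail y" "Head y" r]
  unfolding side_def by (simp add: Tail_in_code_iff Head_in_code_iff)

section \<open>Relative weights as flows\<close>

definition transit :: "'r set \<Rightarrow> 'r set \<Rightarrow> 'r \<Rightarrow> 'r \<Rightarrow> int" where
  "transit P Q p q = of_bool (p \<in> P \<and> q \<in> Q) - of_bool (p \<in> Q \<and> q \<in> P)"

lemma transit_same [simp]: "transit P Q p p = 0"
  by (auto simp: transit_def)

lemma transit_flip: "transit P Q q p = - transit P Q p q"
  by (auto simp: transit_def)

text \<open>
  The map \<open>\<rho>\<close> assigns to every endpoint its region, under any encoding of regions;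
  \<open>P\<close> and \<open>Q\<close> are sets of regions.
\<close>

definition flow :: "(endpt \<Rightarrow> 'r) \<Rightarrow> arrow set \<Rightarrow> 'r set \<Rightarrow> 'r set \<Rightarrow> int" where
  "flow \<rho> C P Q = (\<Sum>c\<in>C. sign c * transit P Q (\<rho> (Tail c)) (\<rho> (Head c)))"

lemma flow_insert:
  "finite C \<Longrightarrow> c \<notin> C \<Longrightarrow>
    flow \<rho> (insert c C) P Q = sign c * transit P Q (\<rho> (Tail c)) (\<rho> (Head c)) + flow \<rho> C P Q"
  by (simp add: flow_def)

lemma flow_cong:
  assumes "\<And>c r. c \<in> C \<Longrightarrow> r \<in> {Tail c, Head c} \<Longrightarrow> (\<rho> r \<in> P \<longleftrightarrow> \<rho>' r \<in> P') \<and> (\<rho> r \<in> Q \<longleftrightarrow> \<rho>' r \<in> Q')"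
  shows "flow \<rho> C P Q = flow \<rho>' C P' Q'"
  unfolding flow_def transit_def using assms by (intro sum.cong) auto

lemma flow_empty_source:
  assumes "\<And>c r. c \<in> C \<Longrightarrow> r \<in> {Tail c, Head c} \<Longrightarrow> \<rho> r \<notin> P"
  shows "flow \<rho> C P Q = 0" "flow \<rho> C Q P = 0"
  unfolding flow_def transit_def using assms by (auto intro!: sum.neutral)

lemma flow_flip: "flow \<rho> C Q P = - flow \<rho> C P Q"
  by (auto simp: flow_def transit_def simp flip: sum_negf intro!: sum.cong)

text \<open>
  Two bits describe the regions of a pair of disjoint arrows. With \<open>\<alpha>\<close> the side of \<open>x\<close>
  on which \<open>y\<close> lies, and \<open>\<beta>\<close> the side of \<open>y\<close> on which \<open>x\<close> lies, the
  middle region is \<open>(\<alpha>, \<beta>)\<close>, the outer regions are \<open>(\<not> \<alpha>, \<beta>)\<close> and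
  \<open>(\<alpha>, \<not> \<beta>)\<close>, and the fourth combination does not occur. Hence one bit suffices to
  single out an outer region.
\<close>

definition region :: "gauss_diagram \<Rightarrow> arrow \<Rightarrow> arrow \<Rightarrow> endpt \<Rightarrow> bool \<times> bool" where
  "region D x y r = (side D x r, side D y r)"

definition pair_flow ::
    "gauss_diagram \<Rightarrow> arrow \<Rightarrow> arrow \<Rightarrow> (bool \<times> bool) set \<Rightarrow> (bool \<times> bool) set \<Rightarrow> int" where
  "pair_flow D x y = flow (region D x y) (arrows D - {x, y})"

text \<open>
  The set \<open>P\<close> lies on one side of \<open>x\<close> and \<open>Q\<close> on the other. So every connecting
  arrow crosses \<open>x\<close>, and its intersection sign is its direction from \<open>P\<close> to \<open>Q\<close>,
  up to a factor that is common to all of them and vanishes in the absolute value.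
\<close>

lemma weight_eq_flow:
  assumes x: "x \<in> arrows D"
    and P: "\<And>c r. c \<in> arrows D - {x, y} \<Longrightarrow> r \<in> {Tail c, Head c} \<Longrightarrow> r \<in> P \<longleftrightarrow> \<rho> r \<in> P'"
    and Q: "\<And>c r. c \<in> arrows D - {x, y} \<Longrightarrow> r \<in> {Tail c, Head c} \<Longrightarrow> r \<in> Q \<longleftrightarrow> \<rho> r \<in> Q'"
    and sides: "\<And>r. \<rho> r \<in> P' \<Longrightarrow> side D x r \<noteq> s"
      "\<And>c r. c \<in> arrows D - {x, y} \<Longrightarrow> r \<in> {Tail c, Head c} \<Longrightarrow> \<rho> r \<in> Q' \<Longrightarrow> side D x r = s"
  shows "weight D x y x P Q = nat \<bar>flow \<rho> (arrows D - {x, y}) P' Q'\<bar>"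
proof -
  let ?C = "arrows D - {x, y}"
  let ?s = "if s then 1 else - 1 :: int"
  have l: "r \<in> left_arc D x \<longleftrightarrow> \<not> side D x r" if "c \<in> ?C" "r \<in> {Tail c, Head c}" for c r
    using that x by (intro mem_left_arc) (auto simp: Tail_in_code_iff Head_in_code_iff)
  have "(\<Sum>c\<in>connecting D x y P Q. sign c * int_sign D x c) =
      (\<Sum>c\<in>?C. if c \<in> connecting D x y P Q then sign c * int_sign D x c else 0)"
    by (rule sum.mono_neutral_cong_left) (auto simp: finite_arrows connecting_def)
  also have "\<dots> = (\<Sum>c\<in>?C. ?s * (sign c * transit P' Q' (\<rho> (Tail c)) (\<rho> (Head c))))"
  proof (rule sum.cong[OF refl])
    fix c assume c: "c \<in> ?C"
    note facts = P[OF c, of "Tail c"] P[OF c, of "Head c"] Q[OF c, of "Tail c"] Q[OF c, of "Head c"]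
      l[OF c, of "Tail c"] l[OF c, of "Head c"]
      sides(1)[of "Tail c"] sides(1)[of "Head c"] sides(2)[OF c, of "Tail c"] sides(2)[OF c, of "Head c"]
    show "(if c \<in> connecting D x y P Q then sign c * int_sign D x c else 0) =
      ?s * (sign c * transit P' Q' (\<rho> (Tail c)) (\<rho> (Head c)))"
      using c facts by (auto simp: connecting_def int_sign_def transit_def mem_right_arc)
  qed
  also have "\<dots> = ?s * flow \<rho> ?C P' Q'"
    by (simp add: flow_def sum_distrib_left)
  finally show ?thesis by (simp add: weight_def abs_mult)
qed

section \<open>The value of a pair of arrows\<close>

text \<open>
  For a pair \<open>x\<close>, \<open>y\<close> the bits \<open>\<alpha>\<close> and \<open>\<beta>\<close> say that
  \<open>x\<close> and \<open>y\<close> are of type h, \<open>l\<close> and \<open>m\<close> are the labels of the middle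
  region with the outer region of \<open>x\<close> and of \<open>y\<close>, and \<open>n\<close> is the label of the
  two outer regions. The four lines are the diagram M for \<open>x, y\<close> and for \<open>y, x\<close>, TT, and HH.
\<close>

definition region_match ::
    "nat \<Rightarrow> nat \<Rightarrow> nat \<Rightarrow> bool \<Rightarrow> bool \<Rightarrow> nat \<Rightarrow> nat \<Rightarrow> nat \<Rightarrow> bool" where
  "region_match i j k \<alpha> \<beta> l m n \<longleftrightarrow>
    \<not> \<alpha> \<and> \<beta> \<and> l = i \<and> m = j \<and> n = k \<or>
    \<alpha> \<and> \<not> \<beta> \<and> m = i \<and> l = j \<and> n = k \<or>
    \<not> \<alpha> \<and> \<not> \<beta> \<and> n = i \<and> (l = j \<and> m = k \<or> l = k \<and> m = j) \<or>
    \<alpha> \<and> \<beta> \<and> n = j \<and> (l = i \<and> m = k \<or> l = k \<and> m = i)"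

text \<open>
  In each of the three diagrams the labels are a permutation of \<open>i\<close>, \<open>j\<close>, \<open>k\<close>.
  This is how distinctness of the indices rules out pairs with two vanishing labels.
\<close>

lemma region_match_distinct:
  assumes "i \<noteq> j" "j \<noteq> k" "k \<noteq> i" "region_match i j k \<alpha> \<beta> l m n"
  shows "l \<noteq> m" "m \<noteq> n" "n \<noteq> l"
  using assms by (auto simp: region_match_def)

definition pair_match :: "nat \<Rightarrow> nat \<Rightarrow> nat \<Rightarrow> gauss_diagram \<Rightarrow> arrow \<Rightarrow> arrow \<Rightarrow> bool" where
  "pair_match i j k D x y \<longleftrightarrow>
    (let \<alpha> = side D x (Tail y); \<beta> = side D y (Tail x)
     in side D x (Head y) = \<alpha> \<and>
        region_match i j k \<alpha> \<beta>
          (nat \<bar>pair_flow D x y {p. fst p \<noteq> \<alpha>} {(\<alpha>, \<beta>)}\<bar>)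
          (nat \<bar>pair_flow D x y {p. snd p \<noteq> \<beta>} {(\<alpha>, \<beta>)}\<bar>)
          (nat \<bar>pair_flow D x y {p. fst p \<noteq> \<alpha>} {p. snd p \<noteq> \<beta>}\<bar>))"

text \<open>
  The hypotheses say that \<open>x\<close> and \<open>y\<close> are disjoint. Their symmetry is proved first, so that the
  facts of this block can be applied to \<open>y, x\<close> in the next one.
\<close>

context
  fixes D x y
  assumes x: "x \<in> arrows D" and y: "y \<in> arrows D" and neq: "x \<noteq> y"
    and disjoint: "side D x (Head y) = side D x (Tail y)"
begin

lemma disjoint_sym: "side D y (Head x) = side D y (Tail x)"
  using side_linked_sym[OF x y neq] disjoint by simp

lemma type_t_iff: "type_t D x y \<longleftrightarrow> \<not> side D x (Tail y)"
  and type_h_iff: "type_h D x y \<longleftrightarrow> side D x (Tail y)"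
  using mem_right_arc[of _ D x] mem_left_arc[OF x, of "Tail y"] mem_left_arc[OF x, of "Head y"]
    y neq disjoint
  by (auto simp: type_t_def type_h_def right_arc_def left_arc_def Tail_in_code_iff Head_in_code_iff)

lemma mem_outer_iff:
  assumes "r \<in> set (code D)" "r \<notin> {Tail x, Head x}"
  shows "r \<in> outer D x y \<longleftrightarrow> side D x r \<noteq> side D x (Tail y)"
  using assms mem_right_arc[of r D x] mem_left_arc[OF x, of r]
  by (auto simp: outer_def type_t_iff right_arc_def left_arc_def)

end

context
  fixes D x y
  assumes x: "x \<in> arrows D" and y: "y \<in> arrows D" and neq: "x \<noteq> y"
    and disjoint: "side D x (Head y) = side D x (Tail y)"
begin

lemmas outer_iffs = mem_outer_iff[OF x y neq disjoint]
  mem_outer_iff[OF y x neq[symmetric] disjoint_sym[OF x y neq disjoint]]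

lemma other_endpoint:
  assumes "c \<in> arrows D - {x, y}" "r \<in> {Tail c, Head c}"
  shows "r \<in> set (code D)" "r \<notin> {Tail x, Head x, Tail y, Head y}"
  using assms by (auto simp: Tail_in_code_iff Head_in_code_iff)

lemma inner_label_eq_flow:
  "inner_label D x y =
    nat \<bar>pair_flow D x y {p. fst p \<noteq> side D x (Tail y)} {(side D x (Tail y), side D y (Tail x))}\<bar>"
  unfolding inner_label_def pair_flow_def
proof (rule weight_eq_flow[OF x, where s = "side D x (Tail y)"])
  fix c r assume "c \<in> arrows D - {x, y}" "r \<in> {Tail c, Head c}"
  note r = other_endpoint[OF this]
  show "r \<in> outer D x y \<longleftrightarrow> region D x y r \<in> {p. fst p \<noteq> side D x (Tail y)}"
    using r outer_iffs by (simp add: region_def)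
  show "r \<in> middle D x y \<longleftrightarrow> region D x y r \<in> {(side D x (Tail y), side D y (Tail x))}"
    using r outer_iffs by (auto simp: region_def middle_def)
qed (auto simp: region_def)

lemma inner_label_eq_flow_swap:
  "inner_label D y x =
    nat \<bar>pair_flow D x y {p. snd p \<noteq> side D y (Tail x)} {(side D x (Tail y), side D y (Tail x))}\<bar>"
  unfolding inner_label_def pair_flow_def insert_commute[of x]
proof (rule weight_eq_flow[OF y, where s = "side D y (Tail x)"])
  fix c r assume "c \<in> arrows D - {y, x}" "r \<in> {Tail c, Head c}"
  then have r: "r \<in> set (code D)" "r \<notin> {Tail x, Head x, Tail y, Head y}"
    using other_endpoint[of c r] by auto
  show "r \<in> outer D y x \<longleftrightarrow> region D x y r \<in> {p. snd p \<noteq> side D y (Tail x)}"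
    using r outer_iffs by (simp add: region_def)
  show "r \<in> middle D y x \<longleftrightarrow> region D x y r \<in> {(side D x (Tail y), side D y (Tail x))}"
    using r outer_iffs by (auto simp: region_def middle_def)
qed (auto simp: region_def)

lemma outer_label_eq_flow:
  "outer_label D x y =
    nat \<bar>pair_flow D x y {p. fst p \<noteq> side D x (Tail y)} {p. snd p \<noteq> side D y (Tail x)}\<bar>"
  unfolding outer_label_def pair_flow_def
proof (rule weight_eq_flow[OF x, where s = "side D x (Tail y)"])
  fix c r assume "c \<in> arrows D - {x, y}" "r \<in> {Tail c, Head c}"
  note r = other_endpoint[OF this]
  show "r \<in> outer D x y \<longleftrightarrow> region D x y r \<in> {p. fst p \<noteq> side D x (Tail y)}"
    using r outer_iffs by (simp add: region_def)
  show "r \<in> outer D y x \<longleftrightarrow> region D x y r \<in> {p. snd p \<noteq> side D y (Tail x)}"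
    using r outer_iffs by (simp add: region_def)
  show "region D x y r \<in> {p. snd p \<noteq> side D y (Tail x)} \<Longrightarrow> side D x r = side D x (Tail y)"
    using r side_dichotomy[OF x y neq _ r] disjoint by (auto simp: region_def)
qed (auto simp: region_def)

lemma outer_label_eq_flow_swap:
  "outer_label D y x =
    nat \<bar>pair_flow D x y {p. fst p \<noteq> side D x (Tail y)} {p. snd p \<noteq> side D y (Tail x)}\<bar>"
proof -
  have "outer_label D y x =
    nat \<bar>flow (region D x y) (arrows D - {y, x}) {p. snd p \<noteq> side D y (Tail x)} {p. fst p \<noteq> side D x (Tail y)}\<bar>"
    unfolding outer_label_def
  proof (rule weight_eq_flow[OF y, where s = "side D y (Tail x)"])
    fix c r assume "c \<in> arrows D - {y, x}" "r \<in> {Tail c, Head c}"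
    then have r: "r \<in> set (code D)" "r \<notin> {Tail x, Head x, Tail y, Head y}"
      using other_endpoint[of c r] by auto
    show "r \<in> outer D x y \<longleftrightarrow> region D x y r \<in> {p. fst p \<noteq> side D x (Tail y)}"
      using r outer_iffs by (simp add: region_def)
    show "r \<in> outer D y x \<longleftrightarrow> region D x y r \<in> {p. snd p \<noteq> side D y (Tail x)}"
      using r outer_iffs by (simp add: region_def)
    show "region D x y r \<in> {p. fst p \<noteq> side D x (Tail y)} \<Longrightarrow> side D y r = side D y (Tail x)"
      using r side_dichotomy[OF x y neq _ r] disjoint by (auto simp: region_def)
  qed (auto simp: region_def)
  then show ?thesis
    unfolding pair_flow_def by (subst (asm) flow_flip) (simp add: insert_commute)
qed

lemma pairing_eq:
  "pairing i j k D {x, y} = (if pair_match i j k D x y then sign x * sign y else 0)"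
proof -
  note types = type_t_iff[OF x y neq disjoint] type_h_iff[OF x y neq disjoint]
    type_t_iff[OF y x neq[symmetric] disjoint_sym[OF x y neq disjoint]]
    type_h_iff[OF y x neq[symmetric] disjoint_sym[OF x y neq disjoint]]
  let ?R = "\<lambda>x y. matches_M i j k D x y \<or> matches_TT i j k D x y \<or> matches_HH i j k D x y"
  have "(\<exists>x' y'. x' \<noteq> y' \<and> {x, y} = {x', y'} \<and> R x' y') \<longleftrightarrow> R x y \<or> R y x" for R
  proof
    show "R x y \<or> R y x" if "\<exists>x' y'. x' \<noteq> y' \<and> {x, y} = {x', y'} \<and> R x' y'"
      using that by (auto simp: doubleton_eq_iff)
    show "\<exists>x' y'. x' \<noteq> y' \<and> {x, y} = {x', y'} \<and> R x' y'" if "R x y \<or> R y x"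
      using that
    proof
      assume "R x y"
      with neq show ?thesis by (intro exI[of _ x] exI[of _ y]) simp
    next
      assume "R y x"
      with neq show ?thesis by (intro exI[of _ y] exI[of _ x]) auto
    qed
  qed
  from this[of ?R]
  have "(\<exists>x' y'. x' \<noteq> y' \<and> {x, y} = {x', y'} \<and> ?R x' y') \<longleftrightarrow> ?R x y \<or> ?R y x" .
  also have "\<dots> \<longleftrightarrow> pair_match i j k D x y"
    unfolding matches_M_def matches_TT_def matches_HH_def pair_match_def Let_def types disjoint
      inner_label_eq_flow inner_label_eq_flow_swap outer_label_eq_flow outer_label_eq_flow_swap region_match_def
    by auto
  finally show ?thesis using neq by (simp add: pairing_def)
qed

end

text \<open>
  Sums over unordered pairs, so that a move which adds arrows can be treated by adding the
  pairs that contain a new arrow.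
\<close>

definition pair_sum :: "'a set \<Rightarrow> ('a set \<Rightarrow> int) \<Rightarrow> int" where
  "pair_sum A g = (\<Sum>S | S \<subseteq> A \<and> card S = 2. g S)"

lemma pair_sum_cong:
  assumes "\<And>x y. x \<in> A \<Longrightarrow> y \<in> A \<Longrightarrow> x \<noteq> y \<Longrightarrow> g {x, y} = h {x, y}"
  shows "pair_sum A g = pair_sum A h"
  unfolding pair_sum_def using assms by (intro sum.cong) (auto simp: card_2_iff)

lemma pair_sum_insert:
  assumes "finite A" "a \<notin> A"
  shows "pair_sum (insert a A) g = pair_sum A g + (\<Sum>y\<in>A. g {a, y})"
proof -
  have "{S. S \<subseteq> insert a A \<and> card S = 2} =
      {S. S \<subseteq> A \<and> card S = 2} \<union> (\<lambda>y. {a, y}) ` A" (is "?L = ?R")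
  proof
    show "?L \<subseteq> ?R"
    proof
      fix S assume S: "S \<in> ?L"
      then obtain x y where "S = {x, y}" "x \<noteq> y" by (auto simp: card_2_iff)
      then show "S \<in> ?R" using S by (auto simp: insert_commute)
    qed
    show "?R \<subseteq> ?L" using assms(2) by (auto simp: card_insert_if)
  qed
  moreover have "inj_on (\<lambda>y. {a, y}) A" by (auto simp: inj_on_def doubleton_eq_iff)
  moreover have "{S. S \<subseteq> A \<and> card S = 2} \<inter> (\<lambda>y. {a, y}) ` A = {}" using assms(2) by auto
  ultimately show ?thesis
    unfolding pair_sum_def using assms(1) by (simp add: sum.union_disjoint sum.reindex)
qed

lemma pair_sum_image:
  assumes "inj_on f A"
  shows "pair_sum (f ` A) g = pair_sum A (\<lambda>S. g (f ` S))"
proof -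
  have "{S. S \<subseteq> f ` A \<and> card S = 2} = (`) f ` {S. S \<subseteq> A \<and> card S = 2}"
    by (auto simp: subset_image_iff card_image[OF inj_on_subset[OF assms]])
  moreover have "inj_on ((`) f) {S. S \<subseteq> A \<and> card S = 2}"
    using inj_on_image_Pow[OF assms] by (rule inj_on_subset) auto
  ultimately show ?thesis unfolding pair_sum_def by (simp add: sum.reindex)
qed

definition pair_value :: "nat \<Rightarrow> nat \<Rightarrow> nat \<Rightarrow> gauss_diagram \<Rightarrow> arrow set \<Rightarrow> int" where
  "pair_value i j k D S = (if \<exists>x\<in>S. \<exists>y\<in>S. intersecting D x y then 0 else pairing i j k D S)"

lemma pair_value_eq:
  assumes "x \<in> arrows D" "y \<in> arrows D" "x \<noteq> y"
  shows "pair_value i j k D {x, y} = (if pair_match i j k D x y then sign x * sign y else 0)"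
proof (cases "side D x (Head y) = side D x (Tail y)")
  case True
  then have "\<not> (\<exists>p\<in>{x, y}. \<exists>q\<in>{x, y}. intersecting D p q)"
    using assms intersecting_iff[of x D y] intersecting_iff[of y D x] side_linked_sym[of x D y]
    by (auto simp: not_intersecting_self)
  then show ?thesis using pairing_eq[OF assms True] by (simp add: pair_value_def)
next
  case False
  then show ?thesis using assms by (auto simp: pair_value_def intersecting_iff pair_match_def Let_def)
qed

lemma three_loop_eq_pair_sum: "three_loop i j k D = pair_sum (arrows D) (pair_value i j k D)"
  unfolding three_loop_def pair_sum_def
  by (rule sum.mono_neutral_cong_left)
    (auto simp: nonintersecting_pairs_def pair_value_def finite_arrows)

text \<open>
  Flows have to be compared for disjoint pairs only. This matters: for an intersecting pair,
  the moves may change them.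
\<close>

lemma pair_match_cong:
  assumes "side D x (Tail y) = side D' x' (Tail y')" "side D x (Head y) = side D' x' (Head y')"
    and "side D y (Tail x) = side D' y' (Tail x')"
    and "\<And>P Q. side D x (Tail y) = side D x (Head y) \<Longrightarrow> pair_flow D x y P Q = pair_flow D' x' y' P Q"
  shows "pair_match i j k D x y = pair_match i j k D' x' y'"
  using assms unfolding pair_match_def Let_def by auto

section \<open>Base point and names of the arrows\<close>

lemma three_loop_rotation:
  assumes "code D = u @ v" "code D' = v @ u"
  shows "three_loop i j k D = three_loop i j k D'"
proof -
  have "code D' = rotate (length u) (code D)" by (simp add: assms rotate_append)
  then have "side D' = side D"
    by (simp add: fun_eq_iff side_def cyclic_rotate distinct_code)
  moreover have "arrows D' = arrows D" by (auto simp: arrows_def assms)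
  ultimately show ?thesis
    unfolding three_loop_eq_pair_sum
    by (auto intro!: pair_sum_cong simp: pair_value_eq pair_match_def pair_flow_def region_def[abs_def])
qed

lemma before_map: "inj_on f (insert p (insert q (set w))) \<Longrightarrow> before (map f w) (f p) (f q) \<longleftrightarrow> before w p q"
  by (induction w) (auto simp: inj_on_def)

lemma three_loop_relabeling:
  assumes inj: "inj_on f (arrows D)" and sgn: "\<And>a. a \<in> arrows D \<Longrightarrow> sign (f a) = sign a"
    and code': "code D' = map (case_endpt (\<lambda>a. Tail (f a)) (\<lambda>a. Head (f a))) (code D)"
  shows "three_loop i j k D = three_loop i j k D'"
proof -
  let ?g = "case_endpt (\<lambda>a. Tail (f a)) (\<lambda>a. Head (f a))"
  have arr: "arrows D' = f ` arrows D"
  proof -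
    have "Tail a = ?g e \<longleftrightarrow> (\<exists>b. e = Tail b \<and> a = f b)" for a e by (cases e) auto
    then show ?thesis unfolding arrows_def code' by (auto simp: image_iff)
  qed
  have g: "inj_on ?g (set (code D))"
    using inj by (auto simp: inj_on_def Tail_in_code_iff Head_in_code_iff split: endpt.splits)
  have bef: "before (code D') (?g p) (?g q) \<longleftrightarrow> before (code D) p q"
    if "p \<in> set (code D)" "q \<in> set (code D)" for p q
    unfolding code' using that g by (intro before_map) (simp add: insert_absorb)
  have sd: "side D' (f x) (Tail (f c)) = side D x (Tail c)" "side D' (f x) (Head (f c)) = side D x (Head c)"
    if "x \<in> arrows D" "c \<in> arrows D" for x c
    using that bef[of "Tail x" "Head x"] bef[of "Tail x" "Tail c"] bef[of "Tail x" "Head c"]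
      bef[of "Tail c" "Head x"] bef[of "Head c" "Head x"] bef[of "Head x" "Tail x"]
    by (simp_all add: side_def cyclic_def Tail_in_code_iff Head_in_code_iff)
  have "pair_value i j k D' {f x, f y} = pair_value i j k D {x, y}"
    if x: "x \<in> arrows D" and y: "y \<in> arrows D" and neq: "x \<noteq> y" for x y
  proof -
    have "pair_flow D' (f x) (f y) P Q = pair_flow D x y P Q" for P Q
    proof -
      have "arrows D' - {f x, f y} = f ` (arrows D - {x, y})"
        using inj x y by (auto simp: arr inj_on_def)
      moreover have "inj_on f (arrows D - {x, y})" using inj by (rule inj_on_subset) auto
      ultimately show ?thesis
        unfolding pair_flow_def flow_def region_def using x y
        by (auto simp: sum.reindex sd sgn intro!: sum.cong)
    qed
    then have "pair_match i j k D x y = pair_match i j k D' (f x) (f y)"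
      using x y by (intro pair_match_cong) (simp_all add: sd)
    moreover have "f x \<noteq> f y" using inj x y neq by (auto dest: inj_onD)
    ultimately show ?thesis using x y neq by (simp add: pair_value_eq arr sgn)
  qed
  then have "pair_sum (arrows D) (pair_value i j k D) = pair_sum (arrows D) (\<lambda>S. pair_value i j k D' (f ` S))"
    by (intro pair_sum_cong) simp
  then show ?thesis
    unfolding three_loop_eq_pair_sum arr by (simp add: pair_sum_image[OF inj])
qed

lemma three_loop_same_diagram: "same_diagram D D' \<Longrightarrow> three_loop i j k D = three_loop i j k D'"
  by (induction rule: same_diagram.induct) (auto intro: three_loop_rotation three_loop_relabeling)

section \<open>The first and second Reidemeister move\<close>

text \<open>
  The ends of \<open>a\<close> are neighbours, so all other endpoints are on the same side of \<open>a\<close>, and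
  the ends of \<open>a\<close> are on the same side of every other arrow. The former makes the outer region
  of \<open>a\<close> empty, the latter makes \<open>a\<close> invisible in all flows.
\<close>

lemma three_loop_R1:
  assumes distinct: "i \<noteq> j" "j \<noteq> k" "k \<noteq> i"
    and code: "code D = u @ v" and code': "code D' = u @ p @ v"
    and p: "p \<in> {[Tail a, Head a], [Head a, Tail a]}"
  shows "three_loop i j k D = three_loop i j k D'"
proof -
  note dist = distinct_code[of D']
  have arr: "arrows D' = insert a (arrows D)" and new: "a \<notin> arrows D"
    using p dist unfolding arrows_def code code' by auto
  have cons: "consecutive (code D') (Tail a) (Head a) \<or> consecutive (code D') (Head a) (Tail a)"
    using p unfolding code' consecutive_def by (elim insertE emptyE) blast+
  have bef: "before (code D) r s \<longleftrightarrow> before (code D') r s"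
    if "r \<notin> {Tail a, Head a}" "s \<notin> {Tail a, Head a}" for r s
    using that p by (elim insertE emptyE; simp add: code code' before_append; blast)
  have old: "side D' x r = side D x r" if "x \<noteq> a" "r \<notin> {Tail a, Head a}" for x r
    using that bef by (simp add: side_def cyclic_def)
  have ends: "side D' x (Tail a) = side D' x (Head a)" if "x \<noteq> a" for x
    using cons that cyclic_consecutive(1)[OF dist] unfolding side_def by fastforce
  have const: "side D' a r = side D' a (Tail y)"
    if "r \<in> {Tail c, Head c}" "c \<in> arrows D" "y \<in> arrows D" for r c y
  proof -
    have "r \<in> set (code D')" "Tail y \<in> set (code D')" "r \<notin> {Tail a, Head a}" "Tail y \<notin> {Tail a, Head a}"
      using that new by (auto simp: Tail_in_code_iff Head_in_code_iff arr)
    then show ?thesis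
      using cons cyclic_within_consecutive(3,4)[OF dist] unfolding side_def by (metis insert_commute)
  qed
  \<comment> \<open>Two of the labels are flows out of the empty outer region of \<open>a\<close>.\<close>
  have zero: "pair_value i j k D' {a, y} = 0" if y: "y \<in> arrows D" for y
  proof -
    have neq: "a \<noteq> y" using y new by auto
    have *: "pair_flow D' a y {p. fst p \<noteq> side D' a (Tail y)} Q = 0" for Q
      unfolding pair_flow_def
    proof (rule flow_empty_source)
      fix c r assume "c \<in> arrows D' - {a, y}" "r \<in> {Tail c, Head c}"
      then show "region D' a y r \<notin> {p. fst p \<noteq> side D' a (Tail y)}"
        using const[of r c y] y by (auto simp: region_def arr)
    qed
    have "\<not> pair_match i j k D' a y"
      using region_match_distinct(3)[OF distinct] unfolding pair_match_def Let_def * by blast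
    then show ?thesis using neq y by (simp add: pair_value_eq arr)
  qed
  have same: "pair_value i j k D' {x, y} = pair_value i j k D {x, y}"
    if x: "x \<in> arrows D" and y: "y \<in> arrows D" and neq: "x \<noteq> y" for x y
  proof -
    have xy: "x \<noteq> a" "y \<noteq> a" using x y new by auto
    have "pair_flow D' x y P Q = pair_flow D x y P Q" for P Q
    proof -
      have "arrows D' - {x, y} = insert a (arrows D - {x, y})" using xy by (auto simp: arr)
      then have "pair_flow D' x y P Q = flow (region D' x y) (arrows D - {x, y}) P Q"
        using new xy by (simp add: pair_flow_def flow_insert finite_arrows region_def ends)
      also have "\<dots> = pair_flow D x y P Q"
        unfolding pair_flow_def
      proof (rule flow_cong)
        fix c r assume "c \<in> arrows D - {x, y}" "r \<in> {Tail c, Head c}"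
        then have "r \<notin> {Tail a, Head a}" using new by auto
        then show "(region D' x y r \<in> P \<longleftrightarrow> region D x y r \<in> P) \<and> (region D' x y r \<in> Q \<longleftrightarrow> region D x y r \<in> Q)"
          using old xy by (simp add: region_def)
      qed
      finally show ?thesis .
    qed
    then have "pair_match i j k D' x y = pair_match i j k D x y"
      using xy by (intro pair_match_cong) (simp_all add: old)
    then show ?thesis using x y neq by (simp add: pair_value_eq arr)
  qed
  have "three_loop i j k D' = pair_sum (arrows D) (pair_value i j k D')"
    unfolding three_loop_eq_pair_sum arr using zero
    by (simp add: pair_sum_insert finite_arrows new)
  also have "\<dots> = three_loop i j k D"
    unfolding three_loop_eq_pair_sum using same by (intro pair_sum_cong)
  finally show ?thesis by simp
qed

text \<open>
  Every other endpoint is on the same side of \<open>a\<close> and \<open>b\<close>, which makes the region between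
  them empty and lets \<open>a\<close> be replaced by \<open>b\<close> in any pair with a third arrow.
\<close>

lemma three_loop_R2:
  assumes distinct: "i \<noteq> j" "j \<noteq> k" "k \<noteq> i"
    and code: "code D = u @ v @ w" and code': "code D' = u @ [Tail a, Tail b] @ v @ p @ w"
    and p: "p \<in> {[Head a, Head b], [Head b, Head a]}" and sgn: "sign b = - sign a"
  shows "three_loop i j k D = three_loop i j k D'"
proof -
  note dist = distinct_code[of D']
  have ab: "a \<noteq> b" using dist unfolding code' by auto
  have arr: "arrows D' = insert a (insert b (arrows D))" and new: "a \<notin> arrows D" "b \<notin> arrows D"
    using p dist unfolding arrows_def code code' by auto
  have tails: "consecutive (code D') (Tail a) (Tail b)"
    unfolding code' consecutive_def by blast
  have heads: "consecutive (code D') (Head a) (Head b) \<or> consecutive (code D') (Head b) (Head a)"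
  proof -
    have "code D' = (u @ [Tail a, Tail b] @ v) @ p @ w" by (simp add: code')
    then show ?thesis using p unfolding consecutive_def by blast
  qed
  have bef: "before (code D) r s \<longleftrightarrow> before (code D') r s"
    if "r \<notin> {Tail a, Head a, Tail b, Head b}" "s \<notin> {Tail a, Head a, Tail b, Head b}" for r s
    using that p by (elim insertE emptyE; simp add: code code' before_append; blast)
  have old: "side D' x r = side D x r"
    if "x \<notin> {a, b}" "r \<notin> {Tail a, Head a, Tail b, Head b}" for x r
    using that bef by (simp add: side_def cyclic_def)
  have ends: "side D' x (Tail a) = side D' x (Tail b)" "side D' x (Head a) = side D' x (Head b)"
    if "x \<notin> {a, b}" for x
    using that cyclic_consecutive(1)[OF dist tails] heads cyclic_consecutive(1)[OF dist] ab
    unfolding side_def by fastforce+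
  have parallel: "side D' a r = side D' b r" if "r \<notin> {Tail a, Head a, Tail b, Head b}" for r
  proof -
    have "side D' a r = cyclic (code D') (Tail b) r (Head a)"
      using that cyclic_consecutive(2)[OF dist tails] by (simp add: side_def)
    also have "\<dots> = side D' b r"
      using that heads cyclic_consecutive(3)[OF dist] unfolding side_def by fastforce
    finally show ?thesis .
  qed
  have mem: "{Tail a, Head a, Tail b, Head b} \<subseteq> set (code D')"
    by (simp add: Tail_in_code_iff Head_in_code_iff arr)
  have bits: "side D' a (Tail b)" "\<not> side D' b (Tail a)" "side D' a (Head b) \<longleftrightarrow> \<not> side D' b (Head a)"
    using cyclic_within_consecutive[OF dist tails, of "Head a"]
      cyclic_within_consecutive[OF dist tails, of "Head b"]
      heads cyclic_within_consecutive[OF dist, of "Head a" "Head b" "Tail a"]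
      cyclic_within_consecutive[OF dist, of "Head b" "Head a" "Tail a"]
      cyclic_within_consecutive[OF dist, of "Head a" "Head b" "Tail b"]
      cyclic_within_consecutive[OF dist, of "Head b" "Head a" "Tail b"] mem ab
    unfolding side_def by auto
  have old_end: "r \<notin> {Tail a, Head a, Tail b, Head b}" if "c \<in> arrows D" "r \<in> {Tail c, Head c}" for c r
    using that new by auto
  have same: "pair_value i j k D' {x, y} = pair_value i j k D {x, y}"
    if x: "x \<in> arrows D" and y: "y \<in> arrows D" and neq: "x \<noteq> y" for x y
  proof -
    have xy: "x \<notin> {a, b}" "y \<notin> {a, b}" using x y new by auto
    have "pair_flow D' x y P Q = pair_flow D x y P Q" for P Q
    proof -
      have "arrows D' - {x, y} = insert a (insert b (arrows D - {x, y}))" using xy by (auto simp: arr)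
      then have "pair_flow D' x y P Q = flow (region D' x y) (arrows D - {x, y}) P Q"
        using new xy ab sgn by (simp add: pair_flow_def flow_insert finite_arrows region_def ends)
      also have "\<dots> = pair_flow D x y P Q"
        unfolding pair_flow_def
      proof (rule flow_cong)
        fix c r assume "c \<in> arrows D - {x, y}" "r \<in> {Tail c, Head c}"
        then have "r \<notin> {Tail a, Head a, Tail b, Head b}" using old_end by blast
        then show "(region D' x y r \<in> P \<longleftrightarrow> region D x y r \<in> P) \<and> (region D' x y r \<in> Q \<longleftrightarrow> region D x y r \<in> Q)"
          using old xy by (simp add: region_def)
      qed
      finally show ?thesis .
    qed
    then have "pair_match i j k D' x y = pair_match i j k D x y"
      using xy x y old_end by (intro pair_match_cong) (auto simp: old)
    then show ?thesis using x y neq by (simp add: pair_value_eq arr)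
  qed
  \<comment> \<open>The pairs \<open>a, y\<close> and \<open>b, y\<close> have the same labels. The only difference
    could come from the remaining arrow, \<open>b\<close> or \<open>a\<close>. If \<open>a\<close> and \<open>b\<close> are
    parallel, it stays in one region; if they intersect, \<open>b\<close> crosses \<open>a\<close> in the direction
    opposite to that in which \<open>a\<close> crosses \<open>b\<close>, which is made up for by the signs.\<close>
  have cancel: "pair_value i j k D' {a, y} + pair_value i j k D' {b, y} = 0" if y: "y \<in> arrows D" for y
  proof -
    have ya: "y \<notin> {a, b}" using y new by auto
    have y_ends: "side D' a (Tail y) = side D' b (Tail y)" "side D' a (Head y) = side D' b (Head y)"
      using parallel old_end[OF y] by auto
    have "pair_match i j k D' a y = pair_match i j k D' b y"
    proof (rule pair_match_cong)
      fix P Q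
      assume "side D' a (Tail y) = side D' a (Head y)"
      then have y_bit: "side D' y (Head a) = side D' y (Tail a)"
        using side_linked_sym[of a D' y] y ya by (auto simp: arr)
      have outside: "flow (region D' a y) (arrows D - {y}) P Q = flow (region D' b y) (arrows D - {y}) P Q"
      proof (rule flow_cong)
        fix c r assume "c \<in> arrows D - {y}" "r \<in> {Tail c, Head c}"
        then have "r \<notin> {Tail a, Head a, Tail b, Head b}" using old_end by blast
        then show "(region D' a y r \<in> P \<longleftrightarrow> region D' b y r \<in> P) \<and> (region D' a y r \<in> Q \<longleftrightarrow> region D' b y r \<in> Q)"
          using parallel by (simp add: region_def)
      qed
      have "arrows D' - {a, y} = insert b (arrows D - {y})" "arrows D' - {b, y} = insert a (arrows D - {y})"
        using ya ab new by (auto simp: arr)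
      then have flows: "pair_flow D' a y P Q =
          sign b * transit P Q (region D' a y (Tail b)) (region D' a y (Head b))
            + flow (region D' a y) (arrows D - {y}) P Q"
        "pair_flow D' b y P Q =
          sign a * transit P Q (region D' b y (Tail a)) (region D' b y (Head a))
            + flow (region D' b y) (arrows D - {y}) P Q"
        using new by (simp_all add: pair_flow_def flow_insert finite_arrows)
      have "side D' y (Tail b) = side D' y (Tail a)" "side D' y (Head b) = side D' y (Tail a)"
        using ends[of y] ya y_bit by simp_all
      then show "pair_flow D' a y P Q = pair_flow D' b y P Q"
        unfolding flows outside using bits sgn y_bit
          transit_flip[of P Q "(False, side D' y (Tail a))" "(True, side D' y (Tail a))"]
        by (cases "side D' b (Head a)") (simp_all add: region_def)
    qed (use y_ends ends[of y] ya in simp_all)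
    then show ?thesis using y ya sgn by (auto simp: pair_value_eq arr)
  qed
  \<comment> \<open>If \<open>a\<close> and \<open>b\<close> are disjoint, no endpoint lies between them, so
    that both flows into the middle region vanish.\<close>
  have zero: "pair_value i j k D' {a, b} = 0"
  proof -
    have "\<not> pair_match i j k D' a b"
    proof
      assume match: "pair_match i j k D' a b"
      have "pair_flow D' a b P {(side D' a (Tail b), side D' b (Tail a))} = 0" for P
        unfolding pair_flow_def
      proof (rule flow_empty_source(2))
        fix c r assume "c \<in> arrows D' - {a, b}" "r \<in> {Tail c, Head c}"
        then have "r \<notin> {Tail a, Head a, Tail b, Head b}" using old_end[of c] by (auto simp: arr)
        then show "region D' a b r \<notin> {(side D' a (Tail b), side D' b (Tail a))}"
          using parallel bits by (simp add: region_def)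
      qed
      then show False
        using match region_match_distinct(1)[OF distinct] unfolding pair_match_def Let_def by fastforce
    qed
    then show ?thesis using ab by (simp add: pair_value_eq arr)
  qed
  have "three_loop i j k D' = pair_sum (arrows D) (pair_value i j k D') +
      (\<Sum>y\<in>arrows D. pair_value i j k D' {a, y} + pair_value i j k D' {b, y})"
    unfolding three_loop_eq_pair_sum arr using zero ab new
    by (simp add: pair_sum_insert finite_arrows sum.distrib)
  also have "\<dots> = pair_sum (arrows D) (pair_value i j k D')" using cancel by simp
  also have "\<dots> = three_loop i j k D"
    unfolding three_loop_eq_pair_sum using same by (intro pair_sum_cong)
  finally show ?thesis by simp
qed

section \<open>The triangle of the third Reidemeister move\<close>

lemma rev_ordered_pair: "s \<in> {1, - 1} \<Longrightarrow> rev (ordered_pair s p q) = ordered_pair (- s) p q"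
  by (auto simp: ordered_pair_def)

lemma set_ordered_pair [simp]: "set (ordered_pair s p q) = {p, q}"
  by (auto simp: ordered_pair_def)

lemma sign_cases: "sign a \<in> {1, - 1}"
  by (simp add: sign_def)

text \<open>
  One side of a third move. Reversing the three strands replaces \<open>e\<close> by \<open>- e\<close>, so that
  both sides of the move are instances of the same configuration, and each fact about it can be
  used twice.
\<close>

definition r3_position :: "int \<Rightarrow> gauss_diagram \<Rightarrow> arrow \<Rightarrow> arrow \<Rightarrow> arrow \<Rightarrow> bool" where
  "r3_position e D a b c \<longleftrightarrow> e \<in> {1, - 1} \<and> distinct [a, b, c] \<and>
    (\<forall>s\<in>r3_strands e a b c. \<exists>u v. code D = u @ s @ v)"

lemma consecutive_ordered_pair:
  assumes "\<exists>u v. w = u @ ordered_pair s p q @ v" "s \<in> {1, - 1}"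
  shows "if s = 1 then consecutive w p q else consecutive w q p"
  using assms unfolding ordered_pair_def consecutive_def by (cases "s = 1") simp_all

context
  fixes e :: int and D a b c
  assumes pos: "r3_position e D a b c"
begin

lemma r3_distinct: "a \<noteq> b" "b \<noteq> c" "a \<noteq> c"
  using pos by (simp_all add: r3_position_def)

lemma r3_signs: "e \<in> {1, - 1}" using pos by (simp add: r3_position_def)

lemma r3_consecutive:
  "if e * sign c = 1 then consecutive (code D) (Tail a) (Tail b) else consecutive (code D) (Tail b) (Tail a)"
  "if e * sign b = 1 then consecutive (code D) (Head a) (Tail c) else consecutive (code D) (Tail c) (Head a)"
  "if e * sign a = 1 then consecutive (code D) (Head b) (Head c) else consecutive (code D) (Head c) (Head b)"
proof -
  have s: "e * sign x \<in> {1, - 1}" for x using sign_cases[of x] r3_signs by auto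
  have ex: "\<exists>u v. code D = u @ s @ v" if "s \<in> r3_strands e a b c" for s
    using pos that by (simp add: r3_position_def)
  show "if e * sign c = 1 then consecutive (code D) (Tail a) (Tail b) else consecutive (code D) (Tail b) (Tail a)"
    "if e * sign b = 1 then consecutive (code D) (Head a) (Tail c) else consecutive (code D) (Tail c) (Head a)"
    "if e * sign a = 1 then consecutive (code D) (Head b) (Head c) else consecutive (code D) (Head c) (Head b)"
    by (intro consecutive_ordered_pair ex s; simp add: r3_strands_def)+
qed

lemma r3_arrows: "a \<in> arrows D" "b \<in> arrows D" "c \<in> arrows D"
proof -
  have "p \<in> set w \<and> q \<in> set w" if "consecutive w p q \<or> consecutive w q p" for w and p q :: endpt
    using that by (auto simp: consecutive_def)
  then show "a \<in> arrows D" "b \<in> arrows D" "c \<in> arrows D"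
    using r3_consecutive(1,2) by (metis Tail_in_code_iff)+
qed

lemma r3_mem:
  "{Tail a, Head a, Tail b, Head b, Tail c, Head c} \<subseteq> set (code D)"
  using r3_arrows by (simp add: Tail_in_code_iff Head_in_code_iff)

lemma r3_mates:
  "x \<notin> {a, b} \<Longrightarrow> side D x (Tail a) = side D x (Tail b)"
  "x \<notin> {a, c} \<Longrightarrow> side D x (Head a) = side D x (Tail c)"
  "x \<notin> {b, c} \<Longrightarrow> side D x (Head b) = side D x (Head c)"
  unfolding side_def using r3_consecutive cyclic_consecutive(1)[OF distinct_code]
  by (auto split: if_splits)

text \<open>
  The position of a neighbour of an end of an arrow relative to that arrow. These six bits are all
  that a third move changes.
\<close>

lemma r3_near_sides:
  "side D a (Tail b) \<longleftrightarrow> e * sign c = 1" "side D b (Tail a) \<longleftrightarrow> e * sign c \<noteq> 1"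
  "side D a (Tail c) \<longleftrightarrow> e * sign b \<noteq> 1" "side D c (Head a) \<longleftrightarrow> e * sign b \<noteq> 1"
  "side D b (Head c) \<longleftrightarrow> e * sign a \<noteq> 1" "side D c (Head b) \<longleftrightarrow> e * sign a = 1"
  unfolding side_def
  using r3_consecutive r3_mem r3_distinct cyclic_within_consecutive[OF distinct_code[of D]]
  by (auto split: if_splits)

lemma r3_via_three_points:
  assumes "r \<notin> {Tail a, Head a, Tail b, Head b, Tail c, Head c}"
  shows "side D a r \<longleftrightarrow> cyclic (code D) (Tail a) r (Tail c)"
    and "side D b r \<longleftrightarrow> cyclic (code D) (Tail a) r (Head b)"
    and "side D c r \<longleftrightarrow> cyclic (code D) (Tail c) r (Head b)"
  unfolding side_def using r3_consecutive r3_distinct assms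
    cyclic_consecutive(2,3)[OF distinct_code[of D]]
  by (auto split: if_splits)

text \<open>
  The bit \<open>side D a (Head b)\<close> is the cyclic order of the three strands: top, bottom, middle
  if it is true, and top, middle, bottom otherwise. It determines on which side of each arrow the
  opposite strand lies.
\<close>

lemma r3_far_sides:
  "side D c (Tail a) = side D a (Head b)" "side D b (Tail c) \<longleftrightarrow> \<not> side D a (Head b)"
proof -
  note turns = cyclic_turn[of "code D" "Tail a" "Head b" "Tail c"]
    cyclic_turn[of "code D" "Head b" "Tail c" "Tail a"]
  have a: "side D a (Head b) \<longleftrightarrow> cyclic (code D) (Tail a) (Head b) (Tail c)"
    "side D c (Tail a) \<longleftrightarrow> cyclic (code D) (Tail c) (Tail a) (Head b)"
    "side D b (Tail c) \<longleftrightarrow> cyclic (code D) (Tail a) (Tail c) (Head b)"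
    unfolding side_def using r3_consecutive r3_distinct cyclic_consecutive(2,3)[OF distinct_code[of D]]
    by (auto split: if_splits)
  show "side D c (Tail a) = side D a (Head b)" using a turns by simp
  show "side D b (Tail c) \<longleftrightarrow> \<not> side D a (Head b)"
    using a turns r3_mem r3_distinct
      cyclic_swap[OF distinct_code[of D], of "Tail a" "Head b" "Tail c"] by simp
qed

text \<open>
  Each endpoint outside of the strands lies on exactly one of the three arcs between them. Each arc
  is cut off by one of the arrows, which joins the two strands at its ends.
\<close>

lemma r3_side_partition:
  assumes "r \<in> set (code D)" "r \<notin> {Tail a, Head a, Tail b, Head b, Tail c, Head c}"
  shows "(side D b r = side D a (Head b)) \<longrightarrow> (side D a r = side D a (Head b))"
    and "(side D c r \<noteq> side D a (Head b)) \<longleftrightarrow> side D a r = side D a (Head b) \<and> side D b r \<noteq> side D a (Head b)"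
proof -
  have "side D a (Head b) \<longleftrightarrow> cyclic (code D) (Tail a) (Head b) (Tail c)"
    unfolding side_def using r3_consecutive r3_distinct cyclic_consecutive(2,3)[OF distinct_code[of D]]
    by (auto split: if_splits)
  then show "(side D b r = side D a (Head b)) \<longrightarrow> (side D a r = side D a (Head b))"
    "(side D c r \<noteq> side D a (Head b)) \<longleftrightarrow> side D a r = side D a (Head b) \<and> side D b r \<noteq> side D a (Head b)"
    using three_arcs[OF distinct_code[of D], of "Tail a" "Tail c" "Head b" r] assms r3_mem r3_distinct
      r3_via_three_points[OF assms(2)]
    by auto
qed

end

text \<open>
  What the third arrow of the triangle adds to the flows of a disjoint pair. The variables are
  the \<open>e\<close> of the configuration, the signs of \<open>a, b, c\<close>, and the cyclic order \<open>\<theta>\<close>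
  of the strands. The three groups are the pairs \<open>a, b\<close>, then \<open>a, c\<close>, then
  \<open>b, c\<close>, each under the condition that the pair is disjoint; within a group the flows are
  outer to middle for the first arrow, for the second, and outer to outer. The point is that the
  results \<open>k12\<close>, \<open>k13\<close>, \<open>k23\<close>, one for each pair of arcs, are the
  same for all pairs (up to the direction of the flow) and depend on the signs only, neither on \<open>e\<close> nor on \<open>\<theta>\<close>.
\<close>

lemma third_arrow_transit:
  fixes e sa sb sc :: int and \<theta> :: bool
  assumes signs: "e \<in> {1, - 1}" "sa \<in> {1, - 1}" "sb \<in> {1, - 1}" "sc \<in> {1, - 1}"
  defines "k12 \<equiv> if sa = sb \<and> sb = sc then sc else 0"
    and "k13 \<equiv> if sa \<noteq> sb \<and> sb = sc then sc else 0"
    and "k23 \<equiv> if sa = sb \<and> sb \<noteq> sc then sc else 0"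
  shows "(e * sc = 1 \<longleftrightarrow> \<theta>) \<Longrightarrow>
      sc * transit {p. fst p \<noteq> \<theta>} {(\<theta>, \<not> \<theta>)}
        (e * sb \<noteq> 1, \<not> \<theta>) (\<theta>, e * sa \<noteq> 1) = k12"
    and "(e * sc = 1 \<longleftrightarrow> \<theta>) \<Longrightarrow>
      sc * transit {p. snd p \<noteq> (\<not> \<theta>)} {(\<theta>, \<not> \<theta>)}
        (e * sb \<noteq> 1, \<not> \<theta>) (\<theta>, e * sa \<noteq> 1) = - k23"
    and "(e * sc = 1 \<longleftrightarrow> \<theta>) \<Longrightarrow>
      sc * transit {p. fst p \<noteq> \<theta>} {p. snd p \<noteq> (\<not> \<theta>)}
        (e * sb \<noteq> 1, \<not> \<theta>) (\<theta>, e * sa \<noteq> 1) = k13"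
    and "(e * sb = - 1 \<longleftrightarrow> \<theta>) \<Longrightarrow>
      sb * transit {p. fst p \<noteq> \<theta>} {(\<theta>, \<theta>)}
        (e * sc = 1, \<theta>) (\<theta>, e * sa = 1) = k13"
    and "(e * sb = - 1 \<longleftrightarrow> \<theta>) \<Longrightarrow>
      sb * transit {p. snd p \<noteq> \<theta>} {(\<theta>, \<theta>)}
        (e * sc = 1, \<theta>) (\<theta>, e * sa = 1) = k23"
    and "(e * sb = - 1 \<longleftrightarrow> \<theta>) \<Longrightarrow>
      sb * transit {p. fst p \<noteq> \<theta>} {p. snd p \<noteq> \<theta>}
        (e * sc = 1, \<theta>) (\<theta>, e * sa = 1) = k12"
    and "(e * sa = 1 \<longleftrightarrow> \<theta>) \<Longrightarrow>
      sa * transit {p. fst p \<noteq> (\<not> \<theta>)} {(\<not> \<theta>, \<theta>)}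
        (e * sc \<noteq> 1, \<theta>) (\<not> \<theta>, e * sb \<noteq> 1) = - k13"
    and "(e * sa = 1 \<longleftrightarrow> \<theta>) \<Longrightarrow>
      sa * transit {p. snd p \<noteq> \<theta>} {(\<not> \<theta>, \<theta>)}
        (e * sc \<noteq> 1, \<theta>) (\<not> \<theta>, e * sb \<noteq> 1) = - k12"
    and "(e * sa = 1 \<longleftrightarrow> \<theta>) \<Longrightarrow>
      sa * transit {p. fst p \<noteq> (\<not> \<theta>)} {p. snd p \<noteq> \<theta>}
        (e * sc \<noteq> 1, \<theta>) (\<not> \<theta>, e * sb \<noteq> 1) = - k23"
  using signs unfolding k12_def k13_def k23_def transit_def
  by (cases \<theta>; auto)+

text \<open>
  Arc 1 is the outer arc of \<open>a\<close>, arc 2 that of \<open>c\<close>, and arc 3 that of \<open>b\<close>.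
\<close>

definition strand_arc :: "gauss_diagram \<Rightarrow> arrow \<Rightarrow> arrow \<Rightarrow> endpt \<Rightarrow> nat" where
  "strand_arc D a b r =
    (if side D a r \<noteq> side D a (Head b) then 1 else if side D b r = side D a (Head b) then 3 else 2)"

definition arc_flow :: "gauss_diagram \<Rightarrow> arrow \<Rightarrow> arrow \<Rightarrow> arrow \<Rightarrow> nat \<Rightarrow> nat \<Rightarrow> int" where
  "arc_flow D a b c p q = flow (strand_arc D a b) (arrows D - {a, b, c}) {p} {q}"

text \<open>
  The flows between arcs 1 and 2, 1 and 3, 2 and 3, including the arrow of the triangle that
  does not belong to the pair under consideration (see \<open>third_arrow_transit\<close>).
\<close>

definition triangle_flow :: "gauss_diagram \<Rightarrow> arrow \<Rightarrow> arrow \<Rightarrow> arrow \<Rightarrow> int \<times> int \<times> int" where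
  "triangle_flow D a b c =
    (arc_flow D a b c 1 2 + (if sign a = sign b \<and> sign b = sign c then sign c else 0),
     arc_flow D a b c 1 3 + (if sign a \<noteq> sign b \<and> sign b = sign c then sign c else 0),
     arc_flow D a b c 2 3 + (if sign a = sign b \<and> sign b \<noteq> sign c then sign c else 0))"

context
  fixes e :: int and D a b c
  assumes pos: "r3_position e D a b c"
begin

text \<open>
  All three pairs within the triangle have the same regions, namely the three arcs, and hence the
  same three labels \<open>l\<close>, \<open>m\<close>, \<open>n\<close>. Only the roles of the arcs differ. The first
  conjunct on the right is disjointness of the pair.
\<close>

lemma r3_pair_match:
  fixes i j k
  defines "\<theta> \<equiv> side D a (Head b)"
  defines "l \<equiv> nat \<bar>fst (triangle_flow D a b c)\<bar>" and "m \<equiv> nat \<bar>fst (snd (triangle_flow D a b c))\<bar>"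
    and "n \<equiv> nat \<bar>snd (snd (triangle_flow D a b c))\<bar>"
  shows "pair_match i j k D a b \<longleftrightarrow> (e * sign c = 1 \<longleftrightarrow> \<theta>) \<and> region_match i j k \<theta> (\<not> \<theta>) l n m"
    and "pair_match i j k D a c \<longleftrightarrow> (e * sign b = - 1 \<longleftrightarrow> \<theta>) \<and> region_match i j k \<theta> \<theta> m n l"
    and "pair_match i j k D b c \<longleftrightarrow> (e * sign a = 1 \<longleftrightarrow> \<theta>) \<and> region_match i j k (\<not> \<theta>) \<theta> m l n"
proof -
  let ?C = "arrows D - {a, b, c}"
  let ?F = "\<lambda>p q. arc_flow D a b c p q"
  note arr = r3_arrows[OF pos] and dist = r3_distinct[OF pos]
  have sides: "side D a (Head b) = \<theta>" "side D a (Head c) = \<theta>" "side D b (Head a) = (\<not> \<theta>)"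
    "side D b (Tail c) = (\<not> \<theta>)" "side D c (Tail a) = \<theta>" "side D c (Tail b) = \<theta>"
    using r3_mates[OF pos] r3_far_sides[OF pos] dist by (auto simp: \<theta>_def)
  note near = r3_near_sides[OF pos]
  have part: "strand_arc D a b r = 1 \<longleftrightarrow> side D a r \<noteq> \<theta>"
    "strand_arc D a b r = 2 \<longleftrightarrow> side D c r \<noteq> \<theta>" "strand_arc D a b r = 3 \<longleftrightarrow> side D b r = \<theta>"
    "side D a r = \<theta> \<and> side D b r = (\<not> \<theta>) \<longleftrightarrow> side D c r \<noteq> \<theta>"
    "side D a r = \<theta> \<and> side D c r = \<theta> \<longleftrightarrow> side D b r = \<theta>"
    "side D b r = (\<not> \<theta>) \<and> side D c r = \<theta> \<longleftrightarrow> side D a r \<noteq> \<theta>"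
    if "d \<in> ?C" "r \<in> {Tail d, Head d}" for d r
    using r3_side_partition[OF pos, of r] that
    by (auto simp: strand_arc_def \<theta>_def Tail_in_code_iff Head_in_code_iff)
  have others: "arrows D - {a, b} = insert c ?C" "arrows D - {a, c} = insert b ?C"
    "arrows D - {b, c} = insert a ?C"
    using arr dist by auto
  have outside:
    "flow (region D a b) ?C {p. fst p \<noteq> \<theta>} {(\<theta>, \<not> \<theta>)} = ?F 1 2"
    "flow (region D a b) ?C {p. snd p \<noteq> (\<not> \<theta>)} {(\<theta>, \<not> \<theta>)} = ?F 3 2"
    "flow (region D a b) ?C {p. fst p \<noteq> \<theta>} {p. snd p \<noteq> (\<not> \<theta>)} = ?F 1 3"
    "flow (region D a c) ?C {p. fst p \<noteq> \<theta>} {(\<theta>, \<theta>)} = ?F 1 3"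
    "flow (region D a c) ?C {p. snd p \<noteq> \<theta>} {(\<theta>, \<theta>)} = ?F 2 3"
    "flow (region D a c) ?C {p. fst p \<noteq> \<theta>} {p. snd p \<noteq> \<theta>} = ?F 1 2"
    "flow (region D b c) ?C {p. fst p \<noteq> (\<not> \<theta>)} {(\<not> \<theta>, \<theta>)} = ?F 3 1"
    "flow (region D b c) ?C {p. snd p \<noteq> \<theta>} {(\<not> \<theta>, \<theta>)} = ?F 2 1"
    "flow (region D b c) ?C {p. fst p \<noteq> (\<not> \<theta>)} {p. snd p \<noteq> \<theta>} = ?F 3 2"
    unfolding arc_flow_def using part
    by (intro flow_cong; simp add: region_def; blast)+
  have flips: "?F 3 2 = - ?F 2 3" "?F 3 1 = - ?F 1 3" "?F 2 1 = - ?F 1 2"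
    unfolding arc_flow_def using flow_flip by blast+
  have flows:
    "pair_flow D a b P Q = sign c * transit P Q (e * sign b \<noteq> 1, \<not> \<theta>) (\<theta>, e * sign a \<noteq> 1)
      + flow (region D a b) ?C P Q"
    "pair_flow D a c P Q = sign b * transit P Q (e * sign c = 1, \<theta>) (\<theta>, e * sign a = 1)
      + flow (region D a c) ?C P Q"
    "pair_flow D b c P Q = sign a * transit P Q (e * sign c \<noteq> 1, \<theta>) (\<not> \<theta>, e * sign b \<noteq> 1)
      + flow (region D b c) ?C P Q"
    for P Q
    unfolding pair_flow_def others
    by (simp_all add: flow_insert finite_arrows) (simp_all add: region_def sides near)
  have minus: "e * sign x = - 1 \<longleftrightarrow> e * sign x \<noteq> 1" for x
    using r3_signs[OF pos] sign_cases[of x] by auto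
  note transits = third_arrow_transit[OF r3_signs[OF pos] sign_cases[of a] sign_cases[of b] sign_cases[of c]]
  obtain F12 F13 F23 where F: "triangle_flow D a b c = (F12, F13, F23)"
    using prod_cases3 by blast
  have ab: "pair_flow D a b {p. fst p \<noteq> \<theta>} {(\<theta>, \<not> \<theta>)} = F12"
    "pair_flow D a b {p. snd p \<noteq> (\<not> \<theta>)} {(\<theta>, \<not> \<theta>)} = - F23"
    "pair_flow D a b {p. fst p \<noteq> \<theta>} {p. snd p \<noteq> (\<not> \<theta>)} = F13"
    if "e * sign c = 1 \<longleftrightarrow> \<theta>"
    unfolding flows outside flips transits(1-3)[OF that] using F by (auto simp: triangle_flow_def)
  have ac: "pair_flow D a c {p. fst p \<noteq> \<theta>} {(\<theta>, \<theta>)} = F13"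
    "pair_flow D a c {p. snd p \<noteq> \<theta>} {(\<theta>, \<theta>)} = F23"
    "pair_flow D a c {p. fst p \<noteq> \<theta>} {p. snd p \<noteq> \<theta>} = F12"
    if "e * sign b = - 1 \<longleftrightarrow> \<theta>"
    unfolding flows outside flips transits(4-6)[OF that] using F by (auto simp: triangle_flow_def)
  have bc: "pair_flow D b c {p. fst p \<noteq> (\<not> \<theta>)} {(\<not> \<theta>, \<theta>)} = - F13"
    "pair_flow D b c {p. snd p \<noteq> \<theta>} {(\<not> \<theta>, \<theta>)} = - F12"
    "pair_flow D b c {p. fst p \<noteq> (\<not> \<theta>)} {p. snd p \<noteq> \<theta>} = - F23"
    if "e * sign a = 1 \<longleftrightarrow> \<theta>"
    unfolding flows outside flips transits(7-9)[OF that] using F by (auto simp: triangle_flow_def)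
  have labels: "nat \<bar>F12\<bar> = l" "nat \<bar>F13\<bar> = m" "nat \<bar>F23\<bar> = n" "\<bar>- F\<bar> = \<bar>F\<bar>" for F :: int
    by (simp_all add: l_def m_def n_def F)
  have "side D a (Tail b) = \<theta> \<longleftrightarrow> (e * sign c = 1 \<longleftrightarrow> \<theta>)" "side D b (Tail a) = (\<not> \<theta>) \<longleftrightarrow> (e * sign c = 1 \<longleftrightarrow> \<theta>)"
    "side D a (Tail c) = \<theta> \<longleftrightarrow> (e * sign b = - 1 \<longleftrightarrow> \<theta>)" "side D b (Head c) = (\<not> \<theta>) \<longleftrightarrow> (e * sign a = 1 \<longleftrightarrow> \<theta>)"
    unfolding near minus by blast+
  note bits = this sides
  show "pair_match i j k D a b \<longleftrightarrow> (e * sign c = 1 \<longleftrightarrow> \<theta>) \<and> region_match i j k \<theta> (\<not> \<theta>) l n m"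
  proof (cases "e * sign c = 1 \<longleftrightarrow> \<theta>")
    case True
    then have *: "side D a (Tail b) = \<theta>" "side D b (Tail a) = (\<not> \<theta>)" using bits by simp_all
    show ?thesis unfolding pair_match_def Let_def * sides ab[OF True] labels using True by simp
  next
    case False
    then show ?thesis using bits by (auto simp: pair_match_def Let_def)
  qed
  show "pair_match i j k D a c \<longleftrightarrow> (e * sign b = - 1 \<longleftrightarrow> \<theta>) \<and> region_match i j k \<theta> \<theta> m n l"
  proof (cases "e * sign b = - 1 \<longleftrightarrow> \<theta>")
    case True
    then have *: "side D a (Tail c) = \<theta>" using bits by simp_all
    show ?thesis unfolding pair_match_def Let_def * sides ac[OF True] labels using True by simp
  next
    case False
    then show ?thesis using bits by (auto simp: pair_match_def Let_def)
  qed
  show "pair_match i j k D b c \<longleftrightarrow> (e * sign a = 1 \<longleftrightarrow> \<theta>) \<and> region_match i j k (\<not> \<theta>) \<theta> m l n"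
  proof (cases "e * sign a = 1 \<longleftrightarrow> \<theta>")
    case True
    then have *: "side D b (Head c) = (\<not> \<theta>)" using bits by simp_all
    show ?thesis unfolding pair_match_def Let_def * sides bc[OF True] labels using True by simp
  next
    case False
    then show ?thesis using bits by (auto simp: pair_match_def Let_def)
  qed
qed

end

text \<open>
  These are the conditions on the labels for the pairs \<open>a, c\<close>, \<open>a, b\<close> and
  \<open>b, c\<close> of a triangle. If \<open>\<theta>\<close> is false then \<open>a\<close> and \<open>c\<close> are of type
  t and \<open>b\<close> is of type h; so \<open>a, c\<close> asks for label \<open>i\<close> between the outer arcs of
  \<open>a\<close> and \<open>c\<close> and leaves the order of the other two free, while \<open>a, b\<close> and
  \<open>b, c\<close> fix one order each. For true \<open>\<theta>\<close> the types are interchanged, and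
  \<open>j\<close> takes the place of \<open>i\<close>.
\<close>

lemma region_match_overlap:
  assumes "i \<noteq> j" "j \<noteq> k" "k \<noteq> i"
  shows "region_match i j k \<theta> \<theta> m n l \<longleftrightarrow>
      region_match i j k \<theta> (\<not> \<theta>) l n m \<or> region_match i j k (\<not> \<theta>) \<theta> m l n"
    and "\<not> (region_match i j k \<theta> (\<not> \<theta>) l n m \<and> region_match i j k (\<not> \<theta>) \<theta> m l n)"
  using assms by (cases \<theta>; auto simp: region_match_def)+

text \<open>
  The sum \<open>T e\<close> is the contribution of the triangle on the side \<open>e\<close> of the move, where
  \<open>\<alpha>\<close> and \<open>\<beta>\<close> are the label conditions for \<open>a, b\<close> and for \<open>b, c\<close>. If
  \<open>\<alpha>\<close> holds, the terms \<open>sa * sb\<close> and \<open>sa * sc\<close> occur on the same side iff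
  \<open>sb = - sc\<close>, and then they cancel; otherwise they occur on different sides and are equal. The
  case of \<open>\<beta>\<close> is similar.
\<close>

lemma triangle_exchange:
  fixes e sa sb sc :: int and \<theta> :: bool
  assumes "e \<in> {1, - 1}" "sa \<in> {1, - 1}" "sb \<in> {1, - 1}" "sc \<in> {1, - 1}"
    and "\<not> (\<alpha> \<and> \<beta>)"
  defines "T \<equiv> \<lambda>e :: int.
      (if (e * sc = 1 \<longleftrightarrow> \<theta>) \<and> \<alpha> then sa * sb else 0) +
      (if (e * sb = - 1 \<longleftrightarrow> \<theta>) \<and> (\<alpha> \<or> \<beta>) then sa * sc else 0) +
      (if (e * sa = 1 \<longleftrightarrow> \<theta>) \<and> \<beta> then sb * sc else 0)"
  shows "T e = T (- e)"
  unfolding T_def using assms(1-5) by (cases \<theta>; cases \<alpha>; cases \<beta>) auto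

section \<open>Invariance under the third Reidemeister move\<close>

context
  fixes D D' p q r u v w z and e :: int and a b c
  assumes code: "code D = u @ p @ v @ q @ w @ r @ z"
    and code': "code D' = u @ rev p @ v @ rev q @ w @ rev r @ z"
    and strands: "{p, q, r} = r3_strands e a b c" and e: "e \<in> {1, -1}"
begin

lemma r3_set: "set (code D') = set (code D)"
  by (auto simp: code code')

lemma r3_arrows_eq: "arrows D' = arrows D"
  by (simp add: arrows_def r3_set)

text \<open>
  The sets of three words on the two sides of the strand equation may be enumerated in different
  orders. As the strands are disjoint parts of a word without repetitions, they are three different
  words, and thus so are those of the configuration.
\<close>

lemma r3_distinct_arrows: "distinct [a, b, c]"
proof -
  let ?s1 = "ordered_pair (e * sign c) (Tail a) (Tail b)"
    and ?s2 = "ordered_pair (e * sign b) (Head a) (Tail c)"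
    and ?s3 = "ordered_pair (e * sign a) (Head b) (Head c)"
  have eq: "{p, q, r} = {?s1, ?s2, ?s3}" using strands by (simp add: r3_strands_def)
  have "[] \<noteq> ordered_pair t x y" for t and x y :: endpt by (simp add: ordered_pair_def)
  then have "s \<noteq> []" if "s \<in> {?s1, ?s2, ?s3}" for s using that by auto
  then have "p \<noteq> []" "q \<noteq> []" "r \<noteq> []" using eq by blast+
  moreover have disj: "set p \<inter> set q = {}" "set p \<inter> set r = {}" "set q \<inter> set r = {}"
    and d: "distinct p" "distinct q" "distinct r"
    using distinct_code[of D] by (auto simp: code)
  ultimately have "p \<noteq> q" "q \<noteq> r" "p \<noteq> r" by auto
  then have "card {?s1, ?s2, ?s3} = 3" unfolding eq[symmetric] by simp
  then have neq: "?s1 \<noteq> ?s2" "?s1 \<noteq> ?s3" "?s2 \<noteq> ?s3" by (auto simp: card_insert_if split: if_splits)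
  have "set s \<inter> set t = {}" if "s \<in> {p, q, r}" "t \<in> {p, q, r}" "s \<noteq> t" for s t
    using that disj by auto
  then have "set ?s1 \<inter> set ?s2 = {}" "set ?s2 \<inter> set ?s3 = {}" using neq unfolding eq by blast+
  moreover have "distinct s" if "s \<in> {p, q, r}" for s using that d by auto
  then have "distinct ?s1" unfolding eq by blast
  ultimately show ?thesis by (auto simp: ordered_pair_def split: if_splits)
qed

lemma r3_position_before: "r3_position e D a b c"
proof -
  have "\<exists>u' v'. code D = u' @ s @ v'" if "s \<in> {p, q, r}" for s
  proof -
    have "code D = u @ p @ (v @ q @ w @ r @ z)" "code D = (u @ p @ v) @ q @ (w @ r @ z)"
      "code D = (u @ p @ v @ q @ w) @ r @ z"
      by (simp_all add: code)
    then show ?thesis using that by blast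
  qed
  then show ?thesis
    using e r3_distinct_arrows unfolding r3_position_def strands by blast
qed

lemma r3_position_after: "r3_position (- e) D' a b c"
proof -
  have "\<exists>u' v'. code D' = u' @ rev s @ v'" if "s \<in> {p, q, r}" for s
  proof -
    have "code D' = u @ rev p @ (v @ rev q @ w @ rev r @ z)"
      "code D' = (u @ rev p @ v) @ rev q @ (w @ rev r @ z)"
      "code D' = (u @ rev p @ v @ rev q @ w) @ rev r @ z"
      by (simp_all add: code')
    then show ?thesis using that by blast
  qed
  moreover have "r3_strands (- e) a b c = rev ` r3_strands e a b c"
  proof -
    have "e * sign x \<in> {1, - 1}" for x using e sign_cases[of x] by auto
    then show ?thesis unfolding r3_strands_def by (simp add: rev_ordered_pair)
  qed
  ultimately show ?thesis
    using e r3_distinct_arrows unfolding r3_position_def strands by auto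
qed

text \<open>
  A third move reverses the order within a strand and nothing else.
\<close>

lemma r3_before_eq:
  assumes "\<not> {x, y} \<subseteq> {Tail a, Tail b}" "\<not> {x, y} \<subseteq> {Head a, Tail c}" "\<not> {x, y} \<subseteq> {Head b, Head c}"
  shows "before (code D') x y = before (code D) x y"
proof -
  have "\<not> {x, y} \<subseteq> set s" if "s \<in> {p, q, r}" for s
    using that assms unfolding strands r3_strands_def by auto
  then have "\<not> {x, y} \<subseteq> set p" "\<not> {x, y} \<subseteq> set q" "\<not> {x, y} \<subseteq> set r" by blast+
  then have "\<not> before s x y" if "s \<in> {p, q, r, rev p, rev q, rev r}" for s
    using that by (auto dest: before_imp_mem)
  then show ?thesis by (simp add: code code' before_append)
qed

lemma r3_old_sides:
  "x \<notin> {a, b, c} \<Longrightarrow> side D' x s = side D x s"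
  "x \<in> {a, b, c} \<Longrightarrow> s \<notin> {Tail a, Head a, Tail b, Head b, Tail c, Head c} \<Longrightarrow> side D' x s = side D x s"
  "side D' a (Head b) = side D a (Head b)" "side D' a (Head c) = side D a (Head c)"
  "side D' b (Head a) = side D b (Head a)" "side D' b (Tail c) = side D b (Tail c)"
  "side D' c (Tail a) = side D c (Tail a)" "side D' c (Tail b) = side D c (Tail b)"
  unfolding side_def cyclic_def using r3_before_eq r3_distinct_arrows by auto

text \<open>
  Only the other two arrows \<open>d\<close>, \<open>d'\<close> of the triangle can change their contribution to
  the flows of a pair of \<open>x\<close> with a bystander \<open>y\<close>.
\<close>

lemma r3_bystander_flow:
  assumes arr: "{x, y, d, d'} \<subseteq> arrows D" "distinct [x, y, d, d']"
    and xdd': "{x, d, d'} = {a, b, c}"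
    and contrib:
      "sign d * transit P Q (region D' x y (Tail d)) (region D' x y (Head d)) +
       sign d' * transit P Q (region D' x y (Tail d')) (region D' x y (Head d')) =
       sign d * transit P Q (region D x y (Tail d)) (region D x y (Head d)) +
       sign d' * transit P Q (region D x y (Tail d')) (region D x y (Head d'))"
  shows "pair_flow D' x y P Q = pair_flow D x y P Q"
proof -
  let ?C = "arrows D - {x, y, d, d'}"
  have C: "arrows D - {x, y} = insert d (insert d' ?C)" using arr by auto
  have y: "y \<notin> {a, b, c}" and x: "x \<in> {a, b, c}" using arr(2) unfolding xdd'[symmetric] by auto
  have "flow (region D' x y) ?C P Q = flow (region D x y) ?C P Q"
  proof (rule flow_cong)
    fix f s assume f: "f \<in> ?C" "s \<in> {Tail f, Head f}"
    then have "f \<notin> {a, b, c}" unfolding xdd'[symmetric] by auto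
    then have "s \<notin> {Tail a, Head a, Tail b, Head b, Tail c, Head c}" using f(2) by auto
    then show "(region D' x y s \<in> P \<longleftrightarrow> region D x y s \<in> P) \<and> (region D' x y s \<in> Q \<longleftrightarrow> region D x y s \<in> Q)"
      using r3_old_sides(1)[OF y] r3_old_sides(2)[OF x] by (simp add: region_def)
  qed
  then show ?thesis
    using contrib arr(2) unfolding pair_flow_def r3_arrows_eq C
    by (simp add: flow_insert finite_arrows)
qed

text \<open>
  Take \<open>x = a\<close>. The arrows \<open>b\<close> and \<open>c\<close> have their heads in a common region
  and their tails next to the ends of \<open>a\<close>. If \<open>b\<close> and \<open>c\<close> have the same
  sign, their tails are on opposite sides of \<open>a\<close> and exchange these sides; if they have opposite
  signs, their tails are on the same side and the contributions cancel before and after the move.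
  The cases of \<open>b\<close> and \<open>c\<close> are analogous. It is here that \<open>x\<close> and \<open>y\<close> have
  to be disjoint: the two ends of \<open>x\<close> must be on the same side of \<open>y\<close>.
\<close>

lemma r3_bystander:
  assumes y: "y \<in> arrows D - {a, b, c}" and x: "x \<in> {a, b, c}"
  shows "pair_match i j k D' x y = pair_match i j k D x y"
proof (rule pair_match_cong)
  note pos = r3_position_before and pos' = r3_position_after
  note arr = r3_arrows[OF pos] and dist = r3_distinct[OF pos]
  have y_end: "s \<notin> {Tail a, Head a, Tail b, Head b, Tail c, Head c}" if "s \<in> {Tail y, Head y}" for s
    using that y by auto
  show x_eq: "side D' x (Tail y) = side D x (Tail y)" "side D' x (Head y) = side D x (Head y)"
    using r3_old_sides(2)[OF x] y_end by auto
  show "side D' y (Tail x) = side D y (Tail x)" using r3_old_sides(1)[of y] y by auto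
  fix P Q
  assume "side D' x (Tail y) = side D' x (Head y)"
  then have xy: "side D y (Tail x) = side D y (Head x)"
    using side_linked_sym[of x D y] x y arr x_eq by auto
  have y_old: "side D' y s = side D y s" for s using r3_old_sides(1)[of y] y by auto
  note mates = r3_mates[OF pos, of y]
  have ya: "y \<notin> {a, b}" "y \<notin> {a, c}" "y \<notin> {b, c}" using y by auto
  have es: "e = 1 \<or> e = - 1" "sign a = 1 \<or> sign a = - 1" "sign b = 1 \<or> sign b = - 1" "sign c = 1 \<or> sign c = - 1"
    using e by (auto simp: sign_def)
  note near = r3_near_sides[OF pos] r3_near_sides[OF pos'] and same = r3_old_sides(3-8)
  have far: "side D a (Head c) = side D a (Head b)" "side D b (Head a) = side D b (Tail c)"
    "side D c (Tail b) = side D c (Tail a)"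
    using r3_mates[OF pos] dist by auto
  note sides = region_def y_old mates(1)[OF ya(1)] mates(2)[OF ya(2)] mates(3)[OF ya(3)] near same far
  consider "x = a" | "x = b" | "x = c" using x by blast
  then show "pair_flow D' x y P Q = pair_flow D x y P Q"
  proof cases
    case 1
    show ?thesis
    proof (rule r3_bystander_flow[of _ _ b c])
      show "{x, y, b, c} \<subseteq> arrows D" "distinct [x, y, b, c]" "{x, b, c} = {a, b, c}"
        using 1 y arr dist by auto
      show "sign b * transit P Q (region D' x y (Tail b)) (region D' x y (Head b)) +
       sign c * transit P Q (region D' x y (Tail c)) (region D' x y (Head c)) =
       sign b * transit P Q (region D x y (Tail b)) (region D x y (Head b)) +
       sign c * transit P Q (region D x y (Tail c)) (region D x y (Head c))"
        using xy[unfolded 1] es unfolding 1 by (elim disjE) (simp_all add: sides)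
    qed
  next
    case 2
    \<comment> \<open>The common region. One of the two arrows starts there and the other one ends there, so
      that the contributions have to be turned into the same direction for comparison.\<close>
    define R where "R = (side D b (Tail c), side D y (Tail c))"
    have flip: "transit P Q R s = - transit P Q s R" for s by (rule transit_flip)
    show ?thesis
    proof (rule r3_bystander_flow[of _ _ a c])
      show "{x, y, a, c} \<subseteq> arrows D" "distinct [x, y, a, c]" "{x, a, c} = {a, b, c}"
        using 2 y arr dist by auto
      show "sign a * transit P Q (region D' x y (Tail a)) (region D' x y (Head a)) +
       sign c * transit P Q (region D' x y (Tail c)) (region D' x y (Head c)) =
       sign a * transit P Q (region D x y (Tail a)) (region D x y (Head a)) +
       sign c * transit P Q (region D x y (Tail c)) (region D x y (Head c))"
        using xy[unfolded 2] es unfolding 2 by (elim disjE) (simp_all add: sides flip flip: R_def)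
    qed
  next
    case 3
    show ?thesis
    proof (rule r3_bystander_flow[of _ _ a b])
      show "{x, y, a, b} \<subseteq> arrows D" "distinct [x, y, a, b]" "{x, a, b} = {a, b, c}"
        using 3 y arr dist by auto
      show "sign a * transit P Q (region D' x y (Tail a)) (region D' x y (Head a)) +
       sign b * transit P Q (region D' x y (Tail b)) (region D' x y (Head b)) =
       sign a * transit P Q (region D x y (Tail a)) (region D x y (Head a)) +
       sign b * transit P Q (region D x y (Tail b)) (region D x y (Head b))"
        using xy[unfolded 3] es unfolding 3 by (elim disjE) (simp_all add: sides)
    qed
  qed
qed

lemma r3_triangle_flow: "triangle_flow D' a b c = triangle_flow D a b c"
proof -
  have "arc_flow D' a b c m n = arc_flow D a b c m n" for m n
    unfolding arc_flow_def r3_arrows_eq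
  proof (rule flow_cong)
    fix f s assume "f \<in> arrows D - {a, b, c}" "s \<in> {Tail f, Head f}"
    then have "s \<notin> {Tail a, Head a, Tail b, Head b, Tail c, Head c}" by auto
    then have "strand_arc D' a b s = strand_arc D a b s"
      using r3_old_sides(2)[of a s] r3_old_sides(2)[of b s] r3_old_sides(3) by (simp add: strand_arc_def)
    then show "(strand_arc D' a b s \<in> {m} \<longleftrightarrow> strand_arc D a b s \<in> {m}) \<and>
      (strand_arc D' a b s \<in> {n} \<longleftrightarrow> strand_arc D a b s \<in> {n})" by simp
  qed
  then show ?thesis by (simp add: triangle_flow_def)
qed

lemma three_loop_R3:
  assumes distinct: "i \<noteq> j" "j \<noteq> k" "k \<noteq> i"
  shows "three_loop i j k D = three_loop i j k D'"
proof -
  note pos = r3_position_before and pos' = r3_position_after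
  note arr = r3_arrows[OF pos] and dist = r3_distinct[OF pos]
  let ?C = "arrows D - {a, b, c}"
  let ?V = "pair_value i j k"
  have A: "arrows D = insert a (insert b (insert c ?C))" using arr by auto
  have split: "three_loop i j k E = pair_sum ?C (?V E) +
      (\<Sum>y\<in>?C. ?V E {a, y}) + (\<Sum>y\<in>?C. ?V E {b, y}) + (\<Sum>y\<in>?C. ?V E {c, y}) +
      (?V E {a, b} + ?V E {a, c} + ?V E {b, c})"
    if "arrows E = arrows D" for E
    unfolding three_loop_eq_pair_sum that by (subst A) (simp add: pair_sum_insert finite_arrows dist)
  have "pair_sum ?C (?V D') = pair_sum ?C (?V D)"
  proof (rule pair_sum_cong)
    fix x y assume xy: "x \<in> ?C" "y \<in> ?C" "x \<noteq> y"
    have "region D' x y = region D x y"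
      using xy r3_old_sides(1) by (auto simp: region_def fun_eq_iff)
    then have "pair_match i j k D' x y = pair_match i j k D x y"
      using xy r3_old_sides(1)[of x] r3_old_sides(1)[of y]
      by (intro pair_match_cong) (auto simp: pair_flow_def r3_arrows_eq)
    then show "?V D' {x, y} = ?V D {x, y}" using xy by (simp add: pair_value_eq r3_arrows_eq)
  qed
  moreover have "(\<Sum>y\<in>?C. ?V D' {x, y}) = (\<Sum>y\<in>?C. ?V D {x, y})" if "x \<in> {a, b, c}" for x
  proof (rule sum.cong[OF refl])
    fix y assume y: "y \<in> ?C"
    then have "x \<in> arrows D" "x \<noteq> y" using that arr by auto
    then show "?V D' {x, y} = ?V D {x, y}"
      using y r3_bystander[OF y that] by (simp add: pair_value_eq r3_arrows_eq)
  qed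
  moreover have "?V D' {a, b} + ?V D' {a, c} + ?V D' {b, c} = ?V D {a, b} + ?V D {a, c} + ?V D {b, c}"
    using triangle_exchange[OF e sign_cases[of a] sign_cases[of b] sign_cases[of c]
        region_match_overlap(2)[OF distinct]] arr dist
    by (simp add: pair_value_eq r3_arrows_eq r3_pair_match[OF pos] r3_pair_match[OF pos'] r3_triangle_flow
      r3_old_sides(3) region_match_overlap(1)[OF distinct])
  ultimately show ?thesis by (simp add: split r3_arrows_eq)
qed

end

section \<open>Virtual knots and linear extension\<close>

lemma three_loop_reidemeister:
  assumes "i \<noteq> j" "j \<noteq> k" "k \<noteq> i" "reidemeister D D'"
  shows "three_loop i j k D = three_loop i j k D'"
  using assms(4)
proof cases
  case R1
  then show ?thesis by (rule three_loop_R1[OF assms(1-3)])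
next
  case R2
  then show ?thesis by (rule three_loop_R2[OF assms(1-3)])
next
  case R3
  then show ?thesis by (rule three_loop_R3[OF _ _ _ _ assms(1-3)])
qed

lemma three_loop_virtual_knot:
  assumes "i \<noteq> j" "j \<noteq> k" "k \<noteq> i" "virtual_knot_of D = virtual_knot_of D'"
  shows "three_loop i j k D = three_loop i j k D'"
proof -
  have "equivclp (sup same_diagram reidemeister) D D'"
    using assms(4) by (simp add: virtual_knot.abs_eq_iff)
  then show ?thesis
  proof (induction rule: equivclp_induct)
    case (step E E')
    then have "three_loop i j k E = three_loop i j k E'"
      using three_loop_same_diagram three_loop_reidemeister[OF assms(1-3)] by (metis sup2E)
    then show ?case using step.IH by simp
  qed simp
qed

lemma frag_linear_extension:
  fixes g :: "'a \<Rightarrow> int"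
  shows "\<exists>!\<Phi> :: ('a \<Rightarrow>\<^sub>0 int) \<Rightarrow> int.
    (\<forall>a b. \<Phi> (a + b) = \<Phi> a + \<Phi> b) \<and> (\<forall>x. \<Phi> (frag_of x) = g x)"
proof
  \<comment> \<open>The integers are the free abelian group on one generator, so that the universal property
    for maps between free abelian groups applies.\<close>
  let ?\<Phi> = "\<lambda>a. Poly_Mapping.lookup (frag_extend (\<lambda>x. frag_cmul (g x) (frag_of ())) a) ()"
  show "(\<forall>a b. ?\<Phi> (a + b) = ?\<Phi> a + ?\<Phi> b) \<and> (\<forall>x. ?\<Phi> (frag_of x) = g x)"
    by (simp add: frag_extend_add lookup_add)
  fix \<Psi> :: "('a \<Rightarrow>\<^sub>0 int) \<Rightarrow> int"
  assume \<Psi>: "(\<forall>a b. \<Psi> (a + b) = \<Psi> a + \<Psi> b) \<and> (\<forall>x. \<Psi> (frag_of x) = g x)"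
  have diff: "\<Psi> (a - b) = \<Psi> a - \<Psi> b" for a b
    using \<Psi> by (metis add_diff_cancel_right' diff_add_cancel)
  show "\<Psi> = ?\<Phi>"
  proof
    fix a :: "'a \<Rightarrow>\<^sub>0 int"
    have "Poly_Mapping.keys a \<subseteq> UNIV" by simp
    then show "\<Psi> a = ?\<Phi> a"
    proof (induction a rule: frag_induction)
      case zero
      show ?case using diff[of 0 0] by simp
    next
      case (one x)
      show ?case using \<Psi> by simp
    next
      case (diff a b)
      then show ?case by (simp add: \<open>\<And>a b. \<Psi> (a - b) = \<Psi> a - \<Psi> b\<close> frag_extend_diff lookup_minus)
    qed
  qed
qed

theorem theorem2:
  fixes i j k :: nat
  assumes "i \<noteq> j" and "j \<noteq> k" and "k \<noteq> i"
  shows "(\<forall>D D'. virtual_knot_of D = virtual_knot_of D' \<longrightarrow> three_loop i j k D = three_loop i j k D') \<and>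
    (\<exists>!\<Phi> :: (virtual_knot \<Rightarrow>\<^sub>0 int) \<Rightarrow> int.
      (\<forall>a b. \<Phi> (a + b) = \<Phi> a + \<Phi> b) \<and>
      (\<forall>D. \<Phi> (frag_of (virtual_knot_of D)) = three_loop i j k D))"
proof
  show inv: "\<forall>D D'. virtual_knot_of D = virtual_knot_of D' \<longrightarrow> three_loop i j k D = three_loop i j k D'"
    using three_loop_virtual_knot[OF assms] by blast
  have surj: "virtual_knot_of (rep_virtual_knot K) = K" for K
    using Quotient_virtual_knot by (rule Quotient_abs_rep)
  have "(\<forall>D. \<Phi> (frag_of (virtual_knot_of D)) = three_loop i j k D) \<longleftrightarrow>
      (\<forall>K. \<Phi> (frag_of K) = three_loop i j k (rep_virtual_knot K))" for \<Phi> :: "(virtual_knot \<Rightarrow>\<^sub>0 int) \<Rightarrow> int"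
    using inv surj by metis
  then show "\<exists>!\<Phi> :: (virtual_knot \<Rightarrow>\<^sub>0 int) \<Rightarrow> int.
      (\<forall>a b. \<Phi> (a + b) = \<Phi> a + \<Phi> b) \<and>
      (\<forall>D. \<Phi> (frag_of (virtual_knot_of D)) = three_loop i j k D)"
    using frag_linear_extension[of "\<lambda>K. three_loop i j k (rep_virtual_knot K)"] by simp
qed

end
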